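(* Let $\delta\in(0,\infty)$, $\epsilon\in(0,1)$ with $\epsilon<\delta$ (for identifiability), and let $\sigma\ge0$ be fixed. For $M>0$ consider the linear model $\bm y=\bm X\bm\beta+\bm z$ under the working hypothesis described in the context, with the two-point prior $\Pi=M$ with probability $\epsilon$ and $\Pi=0$ with probability $1-\epsilon$. Consider the $\ell_0$-penalized estimator $$\widehat{\bm\beta}_0=\operatorname*{argmin}_{\bm b\in\mathbb{R}^p}\ \|\bm y-\bm X\bm b\|^2+\lambda\|\bm b\|_0 .$$ Then we can find $\lambda(M)$ such that, in probability, the discoveries of the estimator $\widehat{\bm\beta}_0$ with $\lambda=\lambda(M)$ obey $$\lim_{M\to\infty}\ \lim_{n,p\to\infty}\ \mathrm{FDP}=0\quad\text{and}\quad\lim_{M\to\infty}\ \lim_{n,p\to\infty}\ \mathrm{TPP}=1.$$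
   Context: Working hypothesis: $\bm X\in\mathbb{R}^{n\times p}$ has i.i.d. $\mathcal N(0,1/n)$ entries; the errors $z_1,\dots,z_n$ are i.i.d. $\mathcal N(0,\sigma^2)$ with $\sigma\ge0$ fixed (the noiseless case $\sigma=0$ is allowed); $\beta_1,\dots,\beta_p$ are independent copies of the random variable $\Pi$; $\bm X,\bm\beta,\bm z$ are independent of each other; $n,p\to\infty$ with $n/p\to\delta$. $\|\cdot\|$ is the Euclidean norm and $\|\bm b\|_0$ is the number of nonzero entries of $\bm b$. A discovery of $\widehat{\bm\beta}_0$ is an index $j$ whose entry $\widehat\beta_{0,j}$ is nonzero; it is false if $\beta_j=0$ and true if $\beta_j\ne0$. The false discovery proportion and true positive proportion are $\mathrm{FDP}=\frac{|\{j:\widehat\beta_{0,j}\ne0,\ \beta_j=0\}|}{\max\{|\{j:\widehat\beta_{0,j}\ne0\}|,1\}}$ and $\mathrm{TPP}=\frac{|\{j:\widehat\beta_{0,j}\neq0,\ \beta_j\ne0\}|}{\max\{|\{j:\beta_j\neq0\}|,1\}}$. *)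

theory Defs
  imports "HOL-Probability.Probability"
begin

text \<open>
  The dimensions \<open>n\<close> and \<open>p\<close> vary along the asymptotics, so vectors in \<open>\<real>\<^sup>p\<close> are functions
  \<open>nat \<Rightarrow> real\<close> and \<open>n \<times> p\<close> matrices functions \<open>nat \<Rightarrow> nat \<Rightarrow> real\<close>, of which only the entries with
  row index below \<open>n\<close> and column index below \<open>p\<close> are ever used.
\<close>

definition l0_norm :: "nat \<Rightarrow> (nat \<Rightarrow> real) \<Rightarrow> nat" where
  "l0_norm p b = card {j. j < p \<and> b j \<noteq> 0}"

definition mat_vec :: "nat \<Rightarrow> (nat \<Rightarrow> nat \<Rightarrow> real) \<Rightarrow> (nat \<Rightarrow> real) \<Rightarrow> nat \<Rightarrow> real" where
  "mat_vec p X b i = (\<Sum>j<p. X i j * b j)"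

definition l0_objective ::
  "nat \<Rightarrow> nat \<Rightarrow> (nat \<Rightarrow> nat \<Rightarrow> real) \<Rightarrow> (nat \<Rightarrow> real) \<Rightarrow> real \<Rightarrow> (nat \<Rightarrow> real) \<Rightarrow> real" where
  "l0_objective n p X y lam b =
     (L2_set (\<lambda>i. y i - mat_vec p X b i) {..<n})\<^sup>2 + lam * real (l0_norm p b)"

definition FDP :: "nat \<Rightarrow> (nat \<Rightarrow> real) \<Rightarrow> (nat \<Rightarrow> real) \<Rightarrow> real" where
  "FDP p bhat \<beta> = real (card {j. j < p \<and> bhat j \<noteq> 0 \<and> \<beta> j = 0}) /
     real (max (card {j. j < p \<and> bhat j \<noteq> 0}) 1)"

definition TPP :: "nat \<Rightarrow> (nat \<Rightarrow> real) \<Rightarrow> (nat \<Rightarrow> real) \<Rightarrow> real" where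
  "TPP p bhat \<beta> = real (card {j. j < p \<and> bhat j \<noteq> 0 \<and> \<beta> j \<noteq> 0}) /
     real (max (card {j. j < p \<and> \<beta> j \<noteq> 0}) 1)"

text \<open>
  The normal law with standard deviation \<open>s \<ge> 0\<close>. The case split is needed because
  \<^const>\<open>normal_density\<close> is not a probability density for \<open>s = 0\<close>.
\<close>

definition normal_law :: "real \<Rightarrow> real \<Rightarrow> real measure" where
  "normal_law \<mu> s =
     (if s = 0 then return borel \<mu> else density lborel (\<lambda>x. ennreal (normal_density \<mu> s x)))"

definition two_point_prior :: "real \<Rightarrow> real \<Rightarrow> real measure" where
  "two_point_prior \<epsilon> M = distr (measure_pmf (bernoulli_pmf \<epsilon>)) borel (\<lambda>b. if b then M else 0)"

definition linear_model ::
  "'a measure \<Rightarrow> nat \<Rightarrow> nat \<Rightarrow> real \<Rightarrow> real measure \<Rightarrow>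
   (nat \<Rightarrow> nat \<Rightarrow> 'a \<Rightarrow> real) \<Rightarrow> (nat \<Rightarrow> 'a \<Rightarrow> real) \<Rightarrow> (nat \<Rightarrow> 'a \<Rightarrow> real) \<Rightarrow>
   (nat \<Rightarrow> 'a \<Rightarrow> real) \<Rightarrow> bool" where
  "linear_model \<Omega> n p \<sigma> Prior X \<beta> z y \<longleftrightarrow>
     prob_space \<Omega> \<and>
     \<comment> \<open>i.i.d. entries within each of \<open>X\<close>, \<open>\<beta>\<close>, \<open>z\<close> and independence of these three objects together
         say that all scalar entries form a single independent family\<close>
     prob_space.indep_vars \<Omega> (\<lambda>_. borel)
       (case_sum (\<lambda>(i, j). X i j) (case_sum \<beta> z))
       (({..<n} \<times> {..<p}) <+> ({..<p} <+> {..<n})) \<and>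
     (\<forall>i<n. \<forall>j<p. distr \<Omega> borel (X i j) = normal_law 0 (sqrt (1 / real n))) \<and>
     (\<forall>j<p. distr \<Omega> borel (\<beta> j) = Prior) \<and>
     (\<forall>i<n. distr \<Omega> borel (z i) = normal_law 0 \<sigma>) \<and>
     (\<forall>i<n. \<forall>\<omega>\<in>space \<Omega>. y i \<omega> = mat_vec p (\<lambda>i j. X i j \<omega>) (\<lambda>j. \<beta> j \<omega>) i + z i \<omega>)"

text \<open>
  The minimiser need not be unique, so the estimator is any random vector that is almost surely
  a minimiser.
\<close>

definition l0_estimator ::
  "'a measure \<Rightarrow> nat \<Rightarrow> nat \<Rightarrow> (nat \<Rightarrow> nat \<Rightarrow> 'a \<Rightarrow> real) \<Rightarrow> (nat \<Rightarrow> 'a \<Rightarrow> real) \<Rightarrow> real \<Rightarrow>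
   (nat \<Rightarrow> 'a \<Rightarrow> real) \<Rightarrow> bool" where
  "l0_estimator \<Omega> n p X y lam bhat \<longleftrightarrow>
     (\<forall>j<p. bhat j \<in> borel_measurable \<Omega>) \<and>
     (AE \<omega> in \<Omega>. is_arg_min
        (l0_objective n p (\<lambda>i j. X i j \<omega>) (\<lambda>i. y i \<omega>) lam) (\<lambda>_. True) (\<lambda>j. bhat j \<omega>))"

definition proportional_regime :: "real \<Rightarrow> (nat \<Rightarrow> nat) \<Rightarrow> (nat \<Rightarrow> nat) \<Rightarrow> bool" where
  "proportional_regime \<delta> n p \<longleftrightarrow>
     filterlim n at_top sequentially \<and> filterlim p at_top sequentially \<and>
     (\<lambda>k. real (n k) / real (p k)) \<longlonglongrightarrow> \<delta>"

text \<open>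
  The iterated limit in probability \<open>lim\<^bsub>M\<rightarrow>\<infinity>\<^esub> lim\<^bsub>k\<rightarrow>\<infinity>\<^esub> Y M k = c\<close>: for every \<open>\<eta> > 0\<close> and all large
  \<open>M\<close>, \<open>\<bar>Y M k - c\<bar> \<le> \<eta>\<close> holds with probability tending to one as \<open>k \<rightarrow> \<infinity>\<close>. If for each \<open>M\<close> the
  sequence \<open>Y M k\<close> converges in probability to a constant \<open>L M\<close>, this says exactly that
  \<open>L M \<rightarrow> c\<close>; the existence of \<open>L M\<close> is not part of the claim, i.e. the inner limits are read as
  inferior and superior limits in probability.
\<close>

definition iterated_lim_in_prob ::
  "(real \<Rightarrow> nat \<Rightarrow> 'a measure) \<Rightarrow> (real \<Rightarrow> nat \<Rightarrow> 'a \<Rightarrow> real) \<Rightarrow> real \<Rightarrow> bool" where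
  "iterated_lim_in_prob \<Omega> Y c \<longleftrightarrow>
     (\<forall>\<eta>>0. \<forall>\<^sub>F M in at_top.
        (\<lambda>k. measure (\<Omega> M k) {\<omega> \<in> space (\<Omega> M k). \<bar>Y M k \<omega> - c\<bar> > \<eta>}) \<longlonglongrightarrow> 0)"

end

theory Submission
  imports Defs "HOL-Real_Asymp.Real_Asymp"
begin

text \<open>
  Take \<open>\<lambda>(M) = M\<close>. Let \<open>S\<close> and \<open>T\<close> be the supports of \<open>\<beta>\<close> and of the estimator. Comparing the
  objective at the estimator with its value at \<open>\<beta>\<close> gives \<open>\<bar>T\<bar> \<le> \<bar>S\<bar> + \<parallel>z\<parallel>\<^sup>2 / M\<close>, hence \<open>\<bar>T\<bar> < n\<close> by a
  linear margin since \<open>\<epsilon> < \<delta>\<close>, and puts \<open>M (\<Sum>j\<in>S - T. X\<^sub>j)\<close> within squared distance \<open>O(M p)\<close> of the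
  span of the columns \<open>X\<^sub>j\<close>, \<open>j \<in> T\<close>. If \<open>\<bar>S - T\<bar> \<ge> h p\<close>, that vector is Gaussian with variance of
  order \<open>M\<^sup>2\<close> per coordinate and independent of the span, so for a fixed pair \<open>(S, T)\<close> this has
  probability at most \<open>(C / M) powr (c p)\<close>, which for large \<open>M\<close> beats the \<open>4 ^ p\<close> pairs.
  Thus \<open>\<bar>S - T\<bar>\<close> and \<open>\<bar>T - S\<bar>\<close> are at most small multiples of \<open>p\<close>.

  The small ball estimate avoids projections. Put
  \<open>W(v) = \<integral> exp (- a \<parallel>v - A b\<parallel>\<^sup>2 - \<kappa> \<parallel>b\<parallel>\<^sup>2) db\<close>. Symmetrising \<open>b\<close> about any \<open>b0\<close> yields
  \<open>W(v) \<ge> exp (- a \<parallel>v - A b0\<parallel>\<^sup>2 - \<kappa> \<parallel>b0\<parallel>\<^sup>2) W(0)\<close>, whereas integrating out \<open>v\<close> first and then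
  rescaling \<open>b\<close> bounds \<open>E W(v) / W(0)\<close> by \<open>(1 + 2 a s\<^sup>2) powr (- (n - t) / 2)\<close> for an \<open>n \<times> t\<close> matrix
  \<open>A\<close>; Markov's inequality concludes. The weight \<open>\<kappa> > 0\<close>, which may be arbitrarily small, makes
  \<open>W\<close> finite without any rank assumption on \<open>A\<close>.
\<close>

subsection \<open>Gaussian integrals with a ridge penalty\<close>

text \<open>Completing the square turns the integrand into a constant times the normal density with
  mean \<open>\<mu>'\<close> and deviation \<open>s'\<close>, which integrates to one. The sign of
  \<open>a\<close> is left free: a negative \<open>a\<close> gives the exponential moment of a
  squared Gaussian.\<close>

lemma nn_integral_exp_square_normal:
  fixes a c s :: real
  assumes "0 < s" "0 < 1 + 2 * a * s\<^sup>2"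
  defines "q \<equiv> 1 + 2 * a * s\<^sup>2"
  shows "(\<integral>\<^sup>+x. ennreal (exp (- (a * (x - c)\<^sup>2))) \<partial>normal_law 0 s) =
    ennreal (q powr (- 1 / 2) * exp (- (a / q * c\<^sup>2)))"
proof -
  have q: "q > 0" using assms by simp
  define \<mu>' s' where "\<mu>' = 2 * a * s\<^sup>2 * c / q" and "s' = s / sqrt q"
  have s': "s' > 0" "s'\<^sup>2 = s\<^sup>2 / q" using assms q by (auto simp: s'_def power_divide)
  have ex: "- (x - 0)\<^sup>2 / (2 * s\<^sup>2) + - (a * (x - c)\<^sup>2) =
      - (a / q * c\<^sup>2) + - (x - \<mu>')\<^sup>2 / (2 * s'\<^sup>2)" for x
  proof -
    have "2 * a * s\<^sup>2 = q - 1" by (simp add: q_def)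
    hence a: "a = (q - 1) / (2 * s\<^sup>2)" using assms(1) by (simp add: field_simps)
    have mu: "\<mu>' = (q - 1) * c / q" by (simp add: \<mu>'_def q_def)
    have minus_div: "- u / D + - ((q - 1) / D * w) = - (u + (q - 1) * w) / D" for u w D :: real
      by (cases "D = 0") (simp_all add: field_simps)
    have core: "x\<^sup>2 + (q - 1) * (x - c)\<^sup>2 = (q - 1) * c\<^sup>2 / q + q * (x - \<mu>')\<^sup>2"
      unfolding mu using q by (simp add: field_simps power2_eq_square)
    have "- (x - 0)\<^sup>2 / (2 * s\<^sup>2) + - (a * (x - c)\<^sup>2) = - (x\<^sup>2 + (q - 1) * (x - c)\<^sup>2) / (2 * s\<^sup>2)"
      unfolding a using minus_div[of "x\<^sup>2" "2 * s\<^sup>2" "(x - c)\<^sup>2"] by (simp only: diff_zero)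
    also have "\<dots> = - ((q - 1) * c\<^sup>2 / q) / (2 * s\<^sup>2) - q * (x - \<mu>')\<^sup>2 / (2 * s\<^sup>2)"
      unfolding core by (simp add: add_divide_distrib diff_divide_distrib)
    also have "\<dots> = - (a / q * c\<^sup>2) + - (x - \<mu>')\<^sup>2 / (2 * s'\<^sup>2)"
      unfolding a s'(2) by (simp add: mult_ac)
    finally show ?thesis .
  qed
  have pw: "q powr (- 1 / 2) = 1 / sqrt q"
    using q powr_minus_divide[of q "1 / 2"] by (simp add: powr_half_sqrt)
  have dens: "normal_density 0 s x * exp (- (a * (x - c)\<^sup>2)) =
      q powr (- 1 / 2) * exp (- (a / q * c\<^sup>2)) * normal_density \<mu>' s' x" for x
  proof -
    have "1 / sqrt (2 * pi * s\<^sup>2) = 1 / sqrt q * (1 / sqrt (2 * pi * s'\<^sup>2))"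
      using q assms(1) by (simp add: s' real_sqrt_mult real_sqrt_divide)
    moreover have "exp (- (x - 0)\<^sup>2 / (2 * s\<^sup>2)) * exp (- (a * (x - c)\<^sup>2)) =
      exp (- (a / q * c\<^sup>2)) * exp (- (x - \<mu>')\<^sup>2 / (2 * s'\<^sup>2))"
      unfolding exp_add[symmetric] using ex[of x] by simp
    ultimately show ?thesis
      unfolding normal_density_def pw by (simp add: mult_ac)
  qed
  interpret N: prob_space "density lborel (\<lambda>x. ennreal (normal_density \<mu>' s' x))"
    by (rule prob_space_normal_density[OF s'(1)])
  have one: "(\<integral>\<^sup>+x. ennreal (normal_density \<mu>' s' x) \<partial>lborel) = 1"
    using N.emeasure_space_1 by (simp add: emeasure_density)
  have "(\<integral>\<^sup>+x. ennreal (exp (- (a * (x - c)\<^sup>2))) \<partial>normal_law 0 s) =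
    (\<integral>\<^sup>+x. ennreal (normal_density 0 s x) * ennreal (exp (- (a * (x - c)\<^sup>2))) \<partial>lborel)"
    using assms(1) by (simp add: normal_law_def nn_integral_density)
  also have "\<dots> = (\<integral>\<^sup>+x. ennreal (q powr (- 1 / 2) * exp (- (a / q * c\<^sup>2))) *
      ennreal (normal_density \<mu>' s' x) \<partial>lborel)"
    by (intro nn_integral_cong) (simp add: dens flip: ennreal_mult)
  also have "\<dots> = ennreal (q powr (- 1 / 2) * exp (- (a / q * c\<^sup>2)))"
    by (simp add: nn_integral_cmult one)
  finally show ?thesis .
qed

text \<open>One coordinate is substituted at a time. The restriction to \<open>J\<close> keeps the
  transformed point extensional, as points of a finite product space are.\<close>

lemma nn_integral_PiM_lborel_affine:
  fixes f :: "('j \<Rightarrow> real) \<Rightarrow> ennreal"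
  assumes "finite J" "c \<noteq> 0" "f \<in> borel_measurable (PiM J (\<lambda>_. lborel))"
  shows "(\<integral>\<^sup>+b. f b \<partial>PiM J (\<lambda>_. lborel)) =
    ennreal (\<bar>c\<bar> ^ card J) * (\<integral>\<^sup>+b. f (\<lambda>j\<in>J. t j + c * b j) \<partial>PiM J (\<lambda>_. lborel))"
  using assms(1,3)
proof (induction J arbitrary: f)
  case empty
  then show ?case by (simp add: space_PiM nn_integral_count_space_finite PiM_empty)
next
  case (insert i J)
  interpret product_sigma_finite "\<lambda>_ :: 'j. lborel :: real measure" ..
  interpret J: finite_product_sigma_finite "\<lambda>_ :: 'j. lborel :: real measure" J
    by standard (use insert in auto)
  have upd: "(\<lambda>(b, y). b(i := y)) \<in> measurable (PiM J (\<lambda>_. lborel) \<Otimes>\<^sub>M lborel)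
      (PiM (insert i J) (\<lambda>_. lborel :: real measure))"
    by (rule measurable_add_dim)
  have [measurable]: "(\<lambda>(b, y). f (b(i := y))) \<in> borel_measurable (PiM J (\<lambda>_. lborel) \<Otimes>\<^sub>M lborel)"
    using measurable_comp[OF upd insert.prems] by (simp add: comp_def case_prod_unfold)
  have [measurable]: "(\<lambda>(y, b). f (b(i := y))) \<in> borel_measurable (borel \<Otimes>\<^sub>M PiM J (\<lambda>_. lborel))"
    using measurable_comp[OF measurable_pair_swap' upd[THEN measurable_comp, OF insert.prems]]
    by (simp add: comp_def case_prod_unfold cong: measurable_cong_sets)
  have "(\<lambda>(y, b). (\<lambda>j\<in>J. t j + c * b j, t i + c * y)) \<in>
      measurable (borel \<Otimes>\<^sub>M PiM J (\<lambda>_. lborel)) (PiM J (\<lambda>_. lborel) \<Otimes>\<^sub>M lborel)"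
    by measurable
  from measurable_comp[OF this upd[THEN measurable_comp, OF insert.prems]]
  have [measurable]: "(\<lambda>(y, b). f ((\<lambda>j\<in>J. t j + c * b j)(i := t i + c * y))) \<in>
      borel_measurable (borel \<Otimes>\<^sub>M PiM J (\<lambda>_. lborel))"
    by (simp add: comp_def case_prod_unfold)
  have "(\<integral>\<^sup>+b. f b \<partial>PiM (insert i J) (\<lambda>_. lborel)) =
      (\<integral>\<^sup>+y. (\<integral>\<^sup>+b. f (b(i := y)) \<partial>PiM J (\<lambda>_. lborel)) \<partial>lborel)"
    using insert by (intro product_nn_integral_insert_rev) auto
  also have "\<dots> = ennreal \<bar>c\<bar> * (\<integral>\<^sup>+y. (\<integral>\<^sup>+b. f (b(i := t i + c * y)) \<partial>PiM J (\<lambda>_. lborel)) \<partial>lborel)"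
    by (intro nn_integral_real_affine assms) measurable
  \<comment> \<open>The induction hypothesis is used for the section of \<open>f\<close> at the
    already transformed coordinate \<open>i\<close>, which is why \<open>f\<close> is
    generalised.\<close>
  also have "\<dots> = ennreal \<bar>c\<bar> * (\<integral>\<^sup>+y. ennreal (\<bar>c\<bar> ^ card J) *
     (\<integral>\<^sup>+b. f ((\<lambda>j\<in>J. t j + c * b j)(i := t i + c * y)) \<partial>PiM J (\<lambda>_. lborel)) \<partial>lborel)"
    by (intro arg_cong2[where f = "(*)"] refl nn_integral_cong insert.IH) measurable
  also have "\<dots> = ennreal \<bar>c\<bar> * (ennreal (\<bar>c\<bar> ^ card J) * (\<integral>\<^sup>+y.
     (\<integral>\<^sup>+b. f ((\<lambda>j\<in>J. t j + c * b j)(i := t i + c * y)) \<partial>PiM J (\<lambda>_. lborel)) \<partial>lborel))"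
    by (intro arg_cong2[where f = "(*)"] refl nn_integral_cmult) measurable
  also have "\<dots> = ennreal (\<bar>c\<bar> ^ card (insert i J)) * (\<integral>\<^sup>+y.
     (\<integral>\<^sup>+b. f ((\<lambda>j\<in>J. t j + c * b j)(i := t i + c * y)) \<partial>PiM J (\<lambda>_. lborel)) \<partial>lborel)"
    using insert(1,2) by (simp add: ennreal_mult mult_ac)
  also have "(\<integral>\<^sup>+y. (\<integral>\<^sup>+b. f ((\<lambda>j\<in>J. t j + c * b j)(i := t i + c * y)) \<partial>PiM J (\<lambda>_. lborel)) \<partial>lborel) =
    (\<integral>\<^sup>+y. (\<integral>\<^sup>+b. f (\<lambda>j\<in>insert i J. t j + c * (b(i := y)) j) \<partial>PiM J (\<lambda>_. lborel)) \<partial>lborel)"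
    using insert(2) by (intro nn_integral_cong arg_cong[where f = f]) (auto simp: fun_eq_iff)
  also have "\<dots> = (\<integral>\<^sup>+b. f (\<lambda>j\<in>insert i J. t j + c * b j) \<partial>PiM (insert i J) (\<lambda>_. lborel))"
    using insert by (intro product_nn_integral_insert_rev[symmetric]) auto
  finally show ?case .
qed

section \<open>Penalised least squares and its partition function\<close>

definition ridge :: "real \<Rightarrow> real \<Rightarrow> 'i set \<Rightarrow> 'j set \<Rightarrow> ('i \<Rightarrow> 'j \<Rightarrow> real) \<Rightarrow> ('i \<Rightarrow> real) \<Rightarrow>
    ('j \<Rightarrow> real) \<Rightarrow> real" where
  "ridge a \<kappa> I J A v b = a * (\<Sum>i\<in>I. (v i - (\<Sum>j\<in>J. A i j * b j))\<^sup>2) + \<kappa> * (\<Sum>j\<in>J. (b j)\<^sup>2)"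

text \<open>This is \<open>W(v)\<close> of the proof idea: up to normalisation, the marginal
  likelihood of \<open>v\<close> in Bayesian linear regression with a Gaussian prior on the
  coefficients. Values in \<open>ennreal\<close> let Tonelli apply without a prior proof of
  finiteness.\<close>

definition ridge_integral :: "real \<Rightarrow> real \<Rightarrow> 'i set \<Rightarrow> 'j set \<Rightarrow> ('i \<Rightarrow> 'j \<Rightarrow> real) \<Rightarrow>
    ('i \<Rightarrow> real) \<Rightarrow> ennreal" where
  "ridge_integral a \<kappa> I J A v =
     (\<integral>\<^sup>+b. ennreal (exp (- ridge a \<kappa> I J A v b)) \<partial>PiM J (\<lambda>_. lborel))"

lemma measurable_ridge [measurable]:
  "(\<lambda>b. ridge a \<kappa> I J A v b) \<in> borel_measurable (PiM J (\<lambda>_. lborel))"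
  unfolding ridge_def by measurable

lemma ridge_cong:
  "(\<And>j. j \<in> J \<Longrightarrow> b j = b' j) \<Longrightarrow> ridge a \<kappa> I J A v b = ridge a \<kappa> I J A v b'"
  unfolding ridge_def by (intro arg_cong2[where f = "(+)"] arg_cong2[where f = "(*)"] refl sum.cong) auto

text \<open>The integrand is positive everywhere and the whole space is not a null set, even for
  empty \<open>J\<close>, where the product measure has mass one. Positivity is what allows division
  by the value at \<open>v = 0\<close>.\<close>

lemma ridge_integral_pos:
  "finite J \<Longrightarrow> ridge_integral a \<kappa> I J A v > 0"
proof -
  assume J: "finite J"
  interpret product_sigma_finite "\<lambda>_ :: 'j. lborel :: real measure" ..
  let ?P = "PiM J (\<lambda>_. lborel :: real measure)"
  have "emeasure ?P (Pi\<^sub>E J (\<lambda>_. UNIV)) = (\<Prod>j\<in>J. emeasure lborel (UNIV :: real set))"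
    using J by (intro emeasure_PiM) auto
  hence ne: "emeasure ?P (space ?P) \<noteq> 0"
    using J by (auto simp: space_PiM)
  have "ridge_integral a \<kappa> I J A v \<noteq> 0"
  proof
    assume "ridge_integral a \<kappa> I J A v = 0"
    hence "AE b in ?P. ennreal (exp (- ridge a \<kappa> I J A v b)) = 0"
      unfolding ridge_integral_def by (subst (asm) nn_integral_0_iff_AE) auto
    hence "AE b in ?P. False" by (simp add: not_le)
    with ne show False by (subst (asm) AE_iff_measurable[OF sets.top]) auto
  qed
  thus ?thesis by (simp add: zero_less_iff_neq_zero)
qed

text \<open>Dropping the residual term leaves a product of one-dimensional Gaussian integrals,
  finite because \<open>\<kappa>\<close> is positive. The matrix is never inspected, so
  rank-deficient ones are covered.\<close>

lemma ridge_integral_finite: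
  assumes "finite J" "0 \<le> a" "0 < \<kappa>"
  shows "ridge_integral a \<kappa> I J A v < \<infinity>"
proof -
  interpret product_sigma_finite "\<lambda>_ :: 'j. lborel :: real measure" ..
  define s where "s = sqrt (1 / (2 * \<kappa>))"
  have s: "s > 0" "s\<^sup>2 = 1 / (2 * \<kappa>)" using assms by (auto simp: s_def)
  interpret N: prob_space "density lborel (\<lambda>x. ennreal (normal_density 0 s x))"
    by (rule prob_space_normal_density[OF s(1)])
  have one: "(\<integral>\<^sup>+x. ennreal (normal_density 0 s x) \<partial>lborel) = 1"
    using N.emeasure_space_1 by (simp add: emeasure_density)
  have e: "exp (- (\<kappa> * x\<^sup>2)) = sqrt (2 * pi * s\<^sup>2) * normal_density 0 s x" for x
    using s(1) assms by (simp add: normal_density_def s(2))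
  have "(\<integral>\<^sup>+x. ennreal (exp (- (\<kappa> * x\<^sup>2))) \<partial>lborel) =
     (\<integral>\<^sup>+x. ennreal (sqrt (2 * pi * s\<^sup>2)) * ennreal (normal_density 0 s x) \<partial>lborel)"
    by (intro nn_integral_cong) (simp add: e ennreal_mult)
  also have "\<dots> < \<infinity>" by (simp add: nn_integral_cmult one)
  finally have fin: "(\<integral>\<^sup>+x. ennreal (exp (- (\<kappa> * x\<^sup>2))) \<partial>lborel) < \<infinity>" .
  have "ridge_integral a \<kappa> I J A v \<le>
     (\<integral>\<^sup>+b. (\<Prod>j\<in>J. ennreal (exp (- (\<kappa> * (b j)\<^sup>2)))) \<partial>PiM J (\<lambda>_. lborel))"
    unfolding ridge_integral_def
  proof (intro nn_integral_mono)
    fix b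
    have "- ridge a \<kappa> I J A v b \<le> (\<Sum>j\<in>J. - (\<kappa> * (b j)\<^sup>2))"
      using assms by (simp add: ridge_def sum_nonneg sum_distrib_left sum_negf)
    hence "exp (- ridge a \<kappa> I J A v b) \<le> exp (\<Sum>j\<in>J. - (\<kappa> * (b j)\<^sup>2))" by simp
    thus "ennreal (exp (- ridge a \<kappa> I J A v b)) \<le> (\<Prod>j\<in>J. ennreal (exp (- (\<kappa> * (b j)\<^sup>2))))"
      using assms by (simp add: exp_sum prod_ennreal ennreal_leI del: exp_le_cancel_iff)
  qed
  also have "\<dots> = (\<Prod>j\<in>J. \<integral>\<^sup>+x. ennreal (exp (- (\<kappa> * x\<^sup>2))) \<partial>lborel)"
    using assms by (intro product_nn_integral_prod) auto
  also have "\<dots> < \<infinity>" using fin by (auto simp: power_less_top_ennreal less_top)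
  finally show ?thesis .
qed

text \<open>Substitute \<open>sqrt q * b\<close> for \<open>b\<close>. At \<open>v = 0\<close> the
  residual term is homogeneous of degree two, so the factor \<open>q\<close> undoes the division of
  \<open>a\<close>; the penalty only grows since \<open>q \<ge> 1\<close>; the Jacobian supplies the
  power of \<open>q\<close>.\<close>

lemma ridge_integral_scale:
  assumes "finite J" "0 \<le> a" "0 \<le> \<kappa>" "1 \<le> q"
  shows "ridge_integral (a / q) \<kappa> I J A (\<lambda>_. 0) \<le>
    ennreal (q powr (card J / 2)) * ridge_integral a \<kappa> I J A (\<lambda>_. 0)"
proof -
  have c: "sqrt q \<noteq> 0" "sqrt q > 0" "sqrt q * sqrt q = q" using assms by auto
  have pw: "\<bar>sqrt q\<bar> ^ card J = q powr (card J / 2)"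
    using c assms by (simp add: powr_half_sqrt[symmetric] powr_realpow[symmetric] powr_powr)
  have le: "ridge a \<kappa> I J A (\<lambda>_. 0) b \<le> ridge (a / q) \<kappa> I J A (\<lambda>_. 0) (\<lambda>j. sqrt q * b j)" for b
  proof -
    have "(\<Sum>i\<in>I. (0 - (\<Sum>j\<in>J. A i j * (sqrt q * b j)))\<^sup>2) = q * (\<Sum>i\<in>I. (0 - (\<Sum>j\<in>J. A i j * b j))\<^sup>2)"
    proof -
      have "(\<Sum>j\<in>J. A i j * (sqrt q * b j)) = sqrt q * (\<Sum>j\<in>J. A i j * b j)" for i
        by (simp add: sum_distrib_left mult_ac)
      thus ?thesis using assms by (simp add: power_mult_distrib flip: sum_distrib_left)
    qed
    moreover have "(\<Sum>j\<in>J. (sqrt q * b j)\<^sup>2) = q * (\<Sum>j\<in>J. (b j)\<^sup>2)"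
      using assms by (simp add: power_mult_distrib sum_distrib_left)
    moreover have "\<kappa> * (\<Sum>j\<in>J. (b j)\<^sup>2) \<le> \<kappa> * (q * (\<Sum>j\<in>J. (b j)\<^sup>2))"
      using assms mult_right_mono[of 1 q "\<Sum>j\<in>J. (b j)\<^sup>2"]
      by (intro mult_left_mono) (auto simp: sum_nonneg)
    ultimately show ?thesis
      using assms unfolding ridge_def by simp
  qed
  have "ridge_integral (a / q) \<kappa> I J A (\<lambda>_. 0) = ennreal (\<bar>sqrt q\<bar> ^ card J) *
     (\<integral>\<^sup>+b. ennreal (exp (- ridge (a / q) \<kappa> I J A (\<lambda>_. 0) (\<lambda>j\<in>J. 0 + sqrt q * b j))) \<partial>PiM J (\<lambda>_. lborel))"
    unfolding ridge_integral_def by (intro nn_integral_PiM_lborel_affine assms c) measurable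
  also have "\<dots> \<le> ennreal (\<bar>sqrt q\<bar> ^ card J) *
     (\<integral>\<^sup>+b. ennreal (exp (- ridge a \<kappa> I J A (\<lambda>_. 0) b)) \<partial>PiM J (\<lambda>_. lborel))"
  proof (intro mult_left_mono nn_integral_mono ennreal_leI)
    fix b
    have "ridge (a / q) \<kappa> I J A (\<lambda>_. 0) (\<lambda>j\<in>J. 0 + sqrt q * b j) =
       ridge (a / q) \<kappa> I J A (\<lambda>_. 0) (\<lambda>j. sqrt q * b j)"
      by (rule ridge_cong) auto
    with le[of b] show "exp (- ridge (a / q) \<kappa> I J A (\<lambda>_. 0) (\<lambda>j\<in>J. 0 + sqrt q * b j)) \<le>
      exp (- ridge a \<kappa> I J A (\<lambda>_. 0) b)" by simp
  qed auto
  finally show ?thesis unfolding pw ridge_integral_def .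
qed

text \<open>After division by \<open>exp (- x)\<close> this is \<open>cosh L \<ge> 1\<close>. It
  disposes of the odd cross term when two reflected points are averaged.\<close>

lemma two_exp_le_exp_add_exp:
  fixes x L :: real
  shows "2 * exp (- x) \<le> exp (- (x + L)) + exp (- (x - L))"
proof -
  have "2 \<le> exp (- L) + exp L" using exp_ge_add_one_self[of L] exp_ge_add_one_self[of "-L"] by linarith
  hence "exp (- x) * 2 \<le> exp (- x) * (exp (- L) + exp L)" by (intro mult_left_mono) auto
  thus ?thesis by (simp add: distrib_left flip: exp_add)
qed

text \<open>Expansion of a quadratic around \<open>b0\<close>. The cross term is linear in
  \<open>t\<close>, so it changes sign between \<open>t = 1\<close> and
  \<open>t = -1\<close>.\<close>

lemma ridge_add:
  "ridge a \<kappa> I J A v (\<lambda>j. b0 j + t * b j) =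
   ridge a \<kappa> I J A v b0 + t\<^sup>2 * ridge a \<kappa> I J A (\<lambda>_. 0) b + t *
   (2 * \<kappa> * (\<Sum>j\<in>J. b0 j * b j) - 2 * a * (\<Sum>i\<in>I. (v i - (\<Sum>j\<in>J. A i j * b0 j)) * (\<Sum>j\<in>J. A i j * b j)))"
proof -
  have 1: "(\<Sum>j\<in>J. A i j * (b0 j + t * b j)) = (\<Sum>j\<in>J. A i j * b0 j) + t * (\<Sum>j\<in>J. A i j * b j)" for i
    by (simp add: sum.distrib sum_distrib_left algebra_simps)
  define x y where "x = (\<lambda>i. \<Sum>j\<in>J. A i j * b0 j)" and "y = (\<lambda>i. \<Sum>j\<in>J. A i j * b j)"
  have xy: "(\<Sum>j\<in>J. A i j * b0 j) = x i" "(\<Sum>j\<in>J. A i j * b j) = y i" for i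
    by (simp_all add: x_def y_def)
  have 2: "(v i - (x i + t * y i))\<^sup>2 = (v i - x i)\<^sup>2 + t\<^sup>2 * (0 - y i)\<^sup>2 - 2 * t * ((v i - x i) * y i)" for i
    by (simp add: power2_eq_square algebra_simps)
  have 3: "(b0 j + t * b j)\<^sup>2 = (b0 j)\<^sup>2 + t\<^sup>2 * (b j)\<^sup>2 + 2 * t * (b0 j * b j)" for j
    by (simp add: power2_eq_square algebra_simps)
  have 4: "(\<Sum>i\<in>I. (v i - (x i + t * y i))\<^sup>2) = (\<Sum>i\<in>I. (v i - x i)\<^sup>2) + t\<^sup>2 * (\<Sum>i\<in>I. (0 - y i)\<^sup>2) -
      2 * t * (\<Sum>i\<in>I. (v i - x i) * y i)"
    by (simp only: 2 sum.distrib sum_subtractf sum_distrib_left)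
  have 5: "(\<Sum>j\<in>J. (b0 j + t * b j)\<^sup>2) = (\<Sum>j\<in>J. (b0 j)\<^sup>2) + t\<^sup>2 * (\<Sum>j\<in>J. (b j)\<^sup>2) +
      2 * t * (\<Sum>j\<in>J. b0 j * b j)"
    by (simp only: 3 sum.distrib sum_distrib_left)
  show ?thesis
    unfolding ridge_def 1 5 xy 4 by (simp add: algebra_simps)
qed

text \<open>Lebesgue measure is invariant under \<open>b0 + b\<close> and \<open>b0 - b\<close>, so
  the integral at \<open>v\<close> is the mean of two shifted integrals. Their cross terms are
  opposite, and \<open>two_exp_le_exp_add_exp\<close> removes them. Since \<open>b0\<close> is
  arbitrary, a single good fit already forces a large integral relative to its value at
  \<open>v = 0\<close>; no minimiser has to be computed.\<close>

lemma ridge_integral_ge: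
  assumes "finite J"
  shows "ennreal (exp (- ridge a \<kappa> I J A v b0)) * ridge_integral a \<kappa> I J A (\<lambda>_. 0) \<le>
    ridge_integral a \<kappa> I J A v"
proof -
  let ?P = "PiM J (\<lambda>_. lborel :: real measure)"
  let ?e = "\<lambda>t b. ennreal (exp (- ridge a \<kappa> I J A v (\<lambda>j. b0 j + t * b j)))"
  have meas: "?e t \<in> borel_measurable ?P" for t
    unfolding ridge_def by measurable
  have shift: "ridge_integral a \<kappa> I J A v = integral\<^sup>N ?P (?e t)" if "\<bar>t\<bar> = 1" for t
  proof -
    have "ridge_integral a \<kappa> I J A v = ennreal (\<bar>t\<bar> ^ card J) *
      (\<integral>\<^sup>+b. ennreal (exp (- ridge a \<kappa> I J A v (\<lambda>j\<in>J. b0 j + t * b j))) \<partial>?P)"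
      unfolding ridge_integral_def using that
      by (intro nn_integral_PiM_lborel_affine assms) auto
    also have "\<dots> = integral\<^sup>N ?P (?e t)"
    proof -
      have "ridge a \<kappa> I J A v (\<lambda>j\<in>J. b0 j + t * b j) = ridge a \<kappa> I J A v (\<lambda>j. b0 j + t * b j)" for b
        by (rule ridge_cong) auto
      thus ?thesis by (simp add: that)
    qed
    finally show ?thesis .
  qed
  \<comment> \<open>Both sides carry a factor 2 so that the averaging involves no division in
    \<open>ennreal\<close>; it is cancelled at the end.\<close>
  have "2 * (ennreal (exp (- ridge a \<kappa> I J A v b0)) * ridge_integral a \<kappa> I J A (\<lambda>_. 0)) =
     (\<integral>\<^sup>+b. 2 * (ennreal (exp (- ridge a \<kappa> I J A v b0)) *
        ennreal (exp (- ridge a \<kappa> I J A (\<lambda>_. 0) b))) \<partial>?P)"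
    unfolding ridge_integral_def by (simp add: nn_integral_cmult)
  also have "\<dots> \<le> (\<integral>\<^sup>+b. ?e 1 b + ?e (-1) b \<partial>?P)"
  proof (intro nn_integral_mono)
    fix b
    define L where "L = 2 * \<kappa> * (\<Sum>j\<in>J. b0 j * b j) -
      2 * a * (\<Sum>i\<in>I. (v i - (\<Sum>j\<in>J. A i j * b0 j)) * (\<Sum>j\<in>J. A i j * b j))"
    let ?x = "ridge a \<kappa> I J A v b0 + ridge a \<kappa> I J A (\<lambda>_. 0) b"
    have "2 * (ennreal (exp (- ridge a \<kappa> I J A v b0)) * ennreal (exp (- ridge a \<kappa> I J A (\<lambda>_. 0) b))) =
      ennreal (2 * exp (- ?x))"
      by (simp add: ennreal_mult exp_diff exp_minus divide_inverse exp_add)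
    also have "\<dots> \<le> ennreal (exp (- (?x + L)) + exp (- (?x - L)))"
      by (intro ennreal_leI two_exp_le_exp_add_exp)
    also have "\<dots> = ?e 1 b + ?e (-1) b"
      unfolding ridge_add by (simp add: L_def)
    finally show "2 * (ennreal (exp (- ridge a \<kappa> I J A v b0)) *
      ennreal (exp (- ridge a \<kappa> I J A (\<lambda>_. 0) b))) \<le> ?e 1 b + ?e (-1) b" .
  qed
  also have "\<dots> = integral\<^sup>N ?P (?e 1) + integral\<^sup>N ?P (?e (-1))"
    by (intro nn_integral_add meas)
  also have "\<dots> = 2 * ridge_integral a \<kappa> I J A v"
    using shift[of 1] shift[of "-1"] by (simp add: mult_2)
  finally show ?thesis
    by (simp add: ennreal_mult_le_mult_iff)
qed

lemma ridge_integral_cong: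
  "(\<And>i. i \<in> I \<Longrightarrow> v i = v' i) \<Longrightarrow> ridge_integral a \<kappa> I J A v = ridge_integral a \<kappa> I J A v'"
proof -
  assume "\<And>i. i \<in> I \<Longrightarrow> v i = v' i"
  hence "ridge a \<kappa> I J A v b = ridge a \<kappa> I J A v' b" for b
    unfolding ridge_def by simp
  thus ?thesis by (simp add: ridge_integral_def)
qed

text \<open>Measurability is in the matrix as well as in \<open>v\<close>, since the columns of the
  design are random too.\<close>

lemma measurable_ridge_integral:
  fixes A :: "'a \<Rightarrow> 'i \<Rightarrow> 'j \<Rightarrow> real"
  assumes J: "finite J"
    and A [measurable]: "\<And>i j. i \<in> I \<Longrightarrow> j \<in> J \<Longrightarrow> (\<lambda>x. A x i j) \<in> borel_measurable N"
    and V [measurable]: "\<And>i. i \<in> I \<Longrightarrow> (\<lambda>x. V x i) \<in> borel_measurable N"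
  shows "(\<lambda>x. ridge_integral a \<kappa> I J (A x) (V x)) \<in> borel_measurable N"
proof -
  interpret J: finite_product_sigma_finite "\<lambda>_ :: 'j. lborel :: real measure" J
    by standard (use J in auto)
  show ?thesis unfolding ridge_integral_def ridge_def by measurable
qed

text \<open>Tonelli puts the expectation inside. For fixed \<open>b\<close> the coordinates of
  \<open>V\<close> factor by independence; each contributes \<open>q powr (- 1 / 2)\<close> and
  replaces \<open>a\<close> by \<open>a / q\<close>. Undoing that replacement with
  \<open>ridge_integral_scale\<close> costs \<open>q powr (1 / 2)\<close> per column, hence the
  difference of dimensions in the exponent.\<close>

lemma (in prob_space) nn_integral_ridge_integral_le:
  fixes V :: "'i \<Rightarrow> 'a \<Rightarrow> real" and A :: "'i \<Rightarrow> 'j \<Rightarrow> real" and a \<kappa> s :: real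
  assumes fin: "finite I" "finite J"
    and ind: "indep_vars (\<lambda>_. borel) V I"
    and law: "\<And>i. i \<in> I \<Longrightarrow> distr M borel (V i) = normal_law 0 s"
    and pos: "0 < s" "0 \<le> a" "0 < \<kappa>"
  defines "q \<equiv> 1 + 2 * a * s\<^sup>2"
  shows "(\<integral>\<^sup>+\<omega>. ridge_integral a \<kappa> I J A (\<lambda>i. V i \<omega>) \<partial>M) \<le>
    ennreal (q powr (- (real (card I) - real (card J)) / 2)) * ridge_integral a \<kappa> I J A (\<lambda>_. 0)"
proof -
  have q1: "q \<ge> 1" using pos by (simp add: q_def)
  have V [measurable]: "i \<in> I \<Longrightarrow> V i \<in> borel_measurable M" for i
    using ind by (auto simp: indep_vars_def)
  interpret J: finite_product_sigma_finite "\<lambda>_ :: 'j. lborel :: real measure" J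
    by standard (use fin in auto)
  interpret P: pair_sigma_finite M "PiM J (\<lambda>_. lborel :: real measure)" ..
  have jm [measurable]: "(\<lambda>(\<omega>, b). ennreal (exp (- ridge a \<kappa> I J A (\<lambda>i. V i \<omega>) b))) \<in>
     borel_measurable (M \<Otimes>\<^sub>M PiM J (\<lambda>_. lborel))"
    unfolding ridge_def by measurable
  have one: "(\<integral>\<^sup>+\<omega>. ennreal (exp (- (a * (V i \<omega> - c)\<^sup>2))) \<partial>M) =
      ennreal (q powr (- 1 / 2) * exp (- (a / q * c\<^sup>2)))" if "i \<in> I" for i c
  proof -
    have "(\<integral>\<^sup>+\<omega>. ennreal (exp (- (a * (V i \<omega> - c)\<^sup>2))) \<partial>M) =
      (\<integral>\<^sup>+x. ennreal (exp (- (a * (x - c)\<^sup>2))) \<partial>distr M borel (V i))"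
      using that by (subst nn_integral_distr) auto
    also have "\<dots> = ennreal (q powr (- 1 / 2) * exp (- (a / q * c\<^sup>2)))"
      unfolding law[OF that] q_def
      by (rule nn_integral_exp_square_normal) (use pos in \<open>auto intro!: add_pos_nonneg\<close>)
    finally show ?thesis .
  qed
  have inner: "(\<integral>\<^sup>+\<omega>. ennreal (exp (- ridge a \<kappa> I J A (\<lambda>i. V i \<omega>) b)) \<partial>M) =
     ennreal (q powr (- real (card I) / 2)) * ennreal (exp (- ridge (a / q) \<kappa> I J A (\<lambda>_. 0) b))" for b
  proof -
    define w where "w = (\<lambda>i. \<Sum>j\<in>J. A i j * b j)"
    define K where "K = exp (- (\<kappa> * (\<Sum>j\<in>J. (b j)\<^sup>2)))"
    have "(\<integral>\<^sup>+\<omega>. ennreal (exp (- ridge a \<kappa> I J A (\<lambda>i. V i \<omega>) b)) \<partial>M) =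
      (\<integral>\<^sup>+\<omega>. ennreal K * ennreal (\<Prod>i\<in>I. exp (- (a * (V i \<omega> - w i)\<^sup>2))) \<partial>M)"
    proof (intro nn_integral_cong)
      fix \<omega>
      have "exp (- ridge a \<kappa> I J A (\<lambda>i. V i \<omega>) b) = K * exp (\<Sum>i\<in>I. - (a * (V i \<omega> - w i)\<^sup>2))"
        by (simp add: ridge_def K_def w_def sum_negf sum_distrib_left flip: exp_add)
      thus "ennreal (exp (- ridge a \<kappa> I J A (\<lambda>i. V i \<omega>) b)) =
        ennreal K * ennreal (\<Prod>i\<in>I. exp (- (a * (V i \<omega> - w i)\<^sup>2)))"
        using fin by (simp add: exp_sum ennreal_mult prod_nonneg K_def)
    qed
    also have "\<dots> = ennreal K * (\<integral>\<^sup>+\<omega>. (\<Prod>i\<in>I. ennreal (exp (- (a * (V i \<omega> - w i)\<^sup>2)))) \<partial>M)"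
      by (subst nn_integral_cmult) (auto simp: prod_ennreal)
    also have "\<dots> = ennreal K * (\<Prod>i\<in>I. \<integral>\<^sup>+\<omega>. ennreal (exp (- (a * (V i \<omega> - w i)\<^sup>2))) \<partial>M)"
      using fin by (subst indep_vars_nn_integral[OF _ indep_vars_compose2[OF ind]]) auto
    also have "\<dots> = ennreal K * (\<Prod>i\<in>I. ennreal (q powr (- 1 / 2) * exp (- (a / q * (w i)\<^sup>2))))"
      by (simp add: one)
    also have "\<dots> = ennreal (K * (\<Prod>i\<in>I. q powr (- 1 / 2) * exp (- (a / q * (w i)\<^sup>2))))"
    proof -
      have "(\<Prod>i\<in>I. ennreal (q powr (- 1 / 2) * exp (- (a / q * (w i)\<^sup>2)))) =
        ennreal (\<Prod>i\<in>I. q powr (- 1 / 2) * exp (- (a / q * (w i)\<^sup>2)))"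
        by (intro prod_ennreal) simp
      thus ?thesis by (simp only:) (intro ennreal_mult[symmetric] prod_nonneg ballI; simp add: K_def)
    qed
    also have "(\<Prod>i\<in>I. q powr (- 1 / 2) * exp (- (a / q * (w i)\<^sup>2))) =
        q powr (- real (card I) / 2) * exp (- (a / q * (\<Sum>i\<in>I. (w i)\<^sup>2)))"
    proof -
      have "(q powr (- 1 / 2)) ^ card I = q powr (- real (card I) / 2)"
        using q1 by (subst powr_realpow[symmetric]) (auto simp: powr_powr)
      moreover have "(\<Prod>i\<in>I. exp (- (a / q * (w i)\<^sup>2))) = exp (- (a / q * (\<Sum>i\<in>I. (w i)\<^sup>2)))"
        using fin by (subst exp_sum[symmetric]) (simp_all add: sum_distrib_left sum_negf)
      ultimately show ?thesis by (simp only: prod.distrib prod_constant)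
    qed
    also have "K * (q powr (- real (card I) / 2) * exp (- (a / q * (\<Sum>i\<in>I. (w i)\<^sup>2)))) =
        q powr (- real (card I) / 2) * exp (- ridge (a / q) \<kappa> I J A (\<lambda>_. 0) b)"
    proof -
      have "- ridge (a / q) \<kappa> I J A (\<lambda>_. 0) b =
        - (\<kappa> * (\<Sum>j\<in>J. (b j)\<^sup>2)) + - (a / q * (\<Sum>i\<in>I. (w i)\<^sup>2))"
        by (simp add: ridge_def w_def)
      thus ?thesis by (simp only: K_def exp_add mult_ac)
    qed
    finally show ?thesis by (simp add: ennreal_mult)
  qed
  have "(\<integral>\<^sup>+\<omega>. ridge_integral a \<kappa> I J A (\<lambda>i. V i \<omega>) \<partial>M) =
      (\<integral>\<^sup>+b. (\<integral>\<^sup>+\<omega>. ennreal (exp (- ridge a \<kappa> I J A (\<lambda>i. V i \<omega>) b)) \<partial>M) \<partial>PiM J (\<lambda>_. lborel))"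
    unfolding ridge_integral_def using P.Fubini'[of "\<lambda>\<omega> b. ennreal (exp (- ridge a \<kappa> I J A (\<lambda>i. V i \<omega>) b))"]
    by simp
  also have "\<dots> = ennreal (q powr (- real (card I) / 2)) * ridge_integral (a / q) \<kappa> I J A (\<lambda>_. 0)"
    unfolding inner ridge_integral_def by (rule nn_integral_cmult) measurable
  also have "\<dots> \<le> ennreal (q powr (- real (card I) / 2)) *
      (ennreal (q powr (card J / 2)) * ridge_integral a \<kappa> I J A (\<lambda>_. 0))"
    using pos q1 fin by (intro mult_left_mono ridge_integral_scale) auto
  also have "\<dots> = ennreal (q powr (- (real (card I) - real (card J)) / 2)) * ridge_integral a \<kappa> I J A (\<lambda>_. 0)"
  proof -
    have "- (real (card I) - real (card J)) / 2 = - real (card I) / 2 + card J / 2"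
      by (simp add: field_simps)
    thus ?thesis by (simp only: powr_add ennreal_mult powr_ge_zero mult.assoc)
  qed
  finally show ?thesis .
qed

subsection \<open>Small ball probabilities for Gaussian matrices\<close>

text \<open>Markov's inequality for the normalised integral. Existence of \<open>b\<close> is an
  uncountable union, so the set is covered by an event instead of being measured itself.
  Independence of \<open>Z\<close> and \<open>V\<close> is given as a product law because the two
  take values in different types.\<close>

lemma (in prob_space) gaussian_small_ball:
  fixes V :: "'i \<Rightarrow> 'a \<Rightarrow> real" and A :: "'z \<Rightarrow> 'i \<Rightarrow> 'j \<Rightarrow> real"
    and a \<kappa> s \<rho> :: real
  assumes fin: "finite I" "finite J"
    and ind: "indep_vars (\<lambda>_. borel) V I"
    and law: "\<And>i. i \<in> I \<Longrightarrow> distr M borel (V i) = normal_law 0 s"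
    and pos: "0 < s" "0 \<le> a" "0 < \<kappa>"
    and Z [measurable]: "Z \<in> measurable M N"
    and prod: "distr M N Z \<Otimes>\<^sub>M distr M (PiM I (\<lambda>_. borel)) (\<lambda>\<omega>. \<lambda>i\<in>I. V i \<omega>) =
      distr M (N \<Otimes>\<^sub>M PiM I (\<lambda>_. borel)) (\<lambda>\<omega>. (Z \<omega>, \<lambda>i\<in>I. V i \<omega>))"
    and A: "\<And>i j. i \<in> I \<Longrightarrow> j \<in> J \<Longrightarrow> (\<lambda>x. A x i j) \<in> borel_measurable N"
  shows "\<exists>E\<in>events. prob E \<le> exp \<rho> * (1 + 2 * a * s\<^sup>2) powr (- (real (card I) - real (card J)) / 2) \<and>
    {\<omega> \<in> space M. \<exists>b. ridge a \<kappa> I J (A (Z \<omega>)) (\<lambda>i. V i \<omega>) b \<le> \<rho>} \<subseteq> E"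
proof -
  define B where "B = (1 + 2 * a * s\<^sup>2) powr (- (real (card I) - real (card J)) / 2)"
  define F where "F z = ridge_integral a \<kappa> I J (A z) (\<lambda>_. 0)" for z
  \<comment> \<open>Dividing by the value at \<open>v = 0\<close> makes the mean over
    \<open>V\<close> bounded by the same \<open>B\<close> for every matrix.\<close>
  define R where "R z v = ridge_integral a \<kappa> I J (A z) v / F z" for z v
  have F: "0 < F z" "F z < \<infinity>" for z
    unfolding F_def using fin pos ridge_integral_pos[of J] ridge_integral_finite[of J a \<kappa>] by auto
  let ?V = "\<lambda>\<omega>. \<lambda>i\<in>I. V i \<omega>"
  let ?Q = "PiM I (\<lambda>_. borel :: real measure)"
  have Vm [measurable]: "?V \<in> measurable M ?Q"
    using ind by (intro measurable_restrict) (auto simp: indep_vars_def)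
  have Am: "(\<lambda>x. A (fst x) i j) \<in> borel_measurable (N \<Otimes>\<^sub>M ?Q)" if "i \<in> I" "j \<in> J" for i j
    using measurable_compose[OF measurable_fst A[OF that]] .
  have Rm [measurable]: "(\<lambda>(z, v). R z v) \<in> borel_measurable (N \<Otimes>\<^sub>M ?Q)"
    unfolding R_def F_def case_prod_unfold
    by (intro borel_measurable_divide_ennreal measurable_ridge_integral Am fin) measurable
  have Rle: "(\<integral>\<^sup>+\<omega>. R z (?V \<omega>) \<partial>M) \<le> ennreal B" for z
  proof -
    have "(\<integral>\<^sup>+\<omega>. R z (?V \<omega>) \<partial>M) = (\<integral>\<^sup>+\<omega>. ridge_integral a \<kappa> I J (A z) (\<lambda>i. V i \<omega>) / F z \<partial>M)"
    proof -
      have "ridge_integral a \<kappa> I J (A z) (?V \<omega>) = ridge_integral a \<kappa> I J (A z) (\<lambda>i. V i \<omega>)" for \<omega>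
        by (rule ridge_integral_cong) simp
      thus ?thesis by (simp add: R_def)
    qed
    also have "\<dots> = (\<integral>\<^sup>+\<omega>. ridge_integral a \<kappa> I J (A z) (\<lambda>i. V i \<omega>) \<partial>M) / F z"
      using ind by (intro nn_integral_divide measurable_ridge_integral fin) (auto simp: indep_vars_def)
    also have "\<dots> \<le> ennreal B * F z / F z"
      unfolding B_def F_def by (intro divide_right_mono_ennreal nn_integral_ridge_integral_le assms)
    also have "\<dots> = ennreal B"
      using F[of z] by (simp add: ennreal_mult_divide_eq)
    finally show ?thesis .
  qed
  interpret D: prob_space "distr M ?Q ?V" by (rule prob_space_distr) measurable
  have "(\<integral>\<^sup>+\<omega>. R (Z \<omega>) (?V \<omega>) \<partial>M) = (\<integral>\<^sup>+x. (case x of (z, v) \<Rightarrow> R z v) \<partial>distr M (N \<Otimes>\<^sub>M ?Q) (\<lambda>\<omega>. (Z \<omega>, ?V \<omega>)))"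
    by (subst nn_integral_distr) auto
  \<comment> \<open>Conditioning on \<open>Z\<close>: by the product law the inner integral is over
    \<open>V\<close> alone, with the matrix frozen at \<open>z\<close>.\<close>
  also have "\<dots> = (\<integral>\<^sup>+z. (\<integral>\<^sup>+v. R z v \<partial>distr M ?Q ?V) \<partial>distr M N Z)"
    unfolding prod[symmetric] by (subst D.nn_integral_fst[symmetric]) auto
  also have "\<dots> \<le> (\<integral>\<^sup>+z. ennreal B \<partial>distr M N Z)"
  proof (intro nn_integral_mono)
    fix z assume "z \<in> space (distr M N Z)"
    hence z: "z \<in> space N" by simp
    have "(\<integral>\<^sup>+v. R z v \<partial>distr M ?Q ?V) = (\<integral>\<^sup>+\<omega>. R z (?V \<omega>) \<partial>M)"
      using measurable_Pair2[OF Rm z] by (intro nn_integral_distr) auto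
    thus "(\<integral>\<^sup>+v. R z v \<partial>distr M ?Q ?V) \<le> ennreal B" using Rle[of z] by simp
  qed
  also have "\<dots> = ennreal B"
    using prob_space.emeasure_space_1[OF prob_space_distr[OF Z]] by simp
  finally have int: "(\<integral>\<^sup>+\<omega>. R (Z \<omega>) (?V \<omega>) \<partial>M) \<le> ennreal B" .
  have RM [measurable]: "(\<lambda>\<omega>. R (Z \<omega>) (?V \<omega>)) \<in> borel_measurable M"
    using measurable_compose[OF measurable_Pair[OF Z Vm] Rm] by simp
  \<comment> \<open>The Markov event at level \<open>exp (- \<rho>)\<close>, written without a
    quotient. A coefficient vector with objective at most \<open>\<rho>\<close> puts
    \<open>\<omega>\<close> there by \<open>ridge_integral_ge\<close>.\<close>
  define E where "E = {\<omega> \<in> space M. 1 \<le> ennreal (exp \<rho>) * R (Z \<omega>) (?V \<omega>)}"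
  have E: "E \<in> events" unfolding E_def by measurable
  have "emeasure M E \<le> ennreal (exp \<rho>) * (\<integral>\<^sup>+\<omega>. R (Z \<omega>) (?V \<omega>) * indicator (space M) \<omega> \<partial>M)"
    unfolding E_def by (intro nn_integral_Markov_inequality) auto
  also have "\<dots> \<le> ennreal (exp \<rho>) * ennreal B"
    using int by (intro mult_left_mono) (auto cong: nn_integral_cong)
  finally have "prob E \<le> exp \<rho> * B"
    by (simp add: emeasure_eq_measure B_def flip: ennreal_mult)
  moreover have "{\<omega> \<in> space M. \<exists>b. ridge a \<kappa> I J (A (Z \<omega>)) (\<lambda>i. V i \<omega>) b \<le> \<rho>} \<subseteq> E"
  proof safe
    fix \<omega> b assume w: "\<omega> \<in> space M" and r: "ridge a \<kappa> I J (A (Z \<omega>)) (\<lambda>i. V i \<omega>) b \<le> \<rho>"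
    define z where "z = Z \<omega>"
    have r': "ridge a \<kappa> I J (A z) (?V \<omega>) b \<le> \<rho>"
      using r by (simp add: ridge_def z_def)
    have "ennreal (exp (- \<rho>)) * F z \<le> ennreal (exp (- ridge a \<kappa> I J (A z) (?V \<omega>) b)) * F z"
      using r' by (intro mult_right_mono ennreal_leI) auto
    also have "\<dots> \<le> ridge_integral a \<kappa> I J (A z) (?V \<omega>)"
      unfolding F_def by (rule ridge_integral_ge[OF fin(2)])
    finally have "ennreal (exp (- \<rho>)) * F z / F z \<le> R z (?V \<omega>)"
      unfolding R_def by (rule divide_right_mono_ennreal)
    hence "ennreal (exp (- \<rho>)) \<le> R z (?V \<omega>)"
      using F[of z] by (simp add: ennreal_mult_divide_eq)
    hence "ennreal (exp \<rho>) * ennreal (exp (- \<rho>)) \<le> ennreal (exp \<rho>) * R z (?V \<omega>)"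
      by (intro mult_left_mono) auto
    thus "\<omega> \<in> E" using w unfolding E_def z_def by (simp add: exp_minus flip: ennreal_mult)
  qed
  ultimately show ?thesis using E unfolding B_def by blast
qed

text \<open>Injectivity makes the index blocks \<open>{f j}\<close> disjoint; evaluating each
  restricted family at its only index returns the variable.\<close>

lemma (in prob_space) indep_vars_reindex_inj:
  assumes ind: "indep_vars (\<lambda>_. N) X I" and f: "inj_on f J" "f ` J \<subseteq> I"
  shows "indep_vars (\<lambda>_. N) (\<lambda>j. X (f j)) J"
proof -
  have "indep_vars (\<lambda>j. PiM {f j} (\<lambda>_. N)) (\<lambda>j \<omega>. restrict (\<lambda>i. X i \<omega>) {f j}) J"
    using f by (intro indep_vars_restrict[OF ind]) (auto simp: disjoint_family_on_def inj_on_def)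
  from indep_vars_compose2[OF this, where Y = "\<lambda>j h. h (f j)" and N = "\<lambda>_. N"]
  show ?thesis by simp
qed

text \<open>Bridge to the facts on sums and affine images of normal variables, which speak of
  \<open>distributed\<close>. At \<open>s = 0\<close> the law is a point mass and has no
  density.\<close>

lemma distributed_normal_iff_distr:
  assumes "s \<noteq> 0"
  shows "distributed M lborel X (normal_density \<mu> s) \<longleftrightarrow>
    X \<in> borel_measurable M \<and> distr M borel X = normal_law \<mu> s"
proof -
  have "distr M lborel X = distr M borel X" by (rule distr_cong) auto
  thus ?thesis using assms by (auto simp: distributed_def normal_law_def)
qed

text \<open>The entries of the combined column are independent Gaussians with variance
  \<open>c\<^sup>2 * card D * s\<^sup>2\<close>. They involve only columns in \<open>D\<close>, so
  they are independent of the matrix formed by the disjoint columns in \<open>T\<close>.\<close>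

lemma (in prob_space) gaussian_matrix_small_ball:
  fixes X :: "'i \<times> 'j \<Rightarrow> 'a \<Rightarrow> real" and a c s \<kappa> \<rho> :: real
  assumes fin: "finite I" "finite D" "finite T" and DT: "D \<inter> T = {}" "D \<noteq> {}"
    and ind: "indep_vars (\<lambda>_. borel) X (I \<times> (D \<union> T))"
    and law: "\<And>i j. i \<in> I \<Longrightarrow> j \<in> D \<Longrightarrow> distr M borel (X (i, j)) = normal_law 0 s"
    and pos: "0 < s" "0 < c" "0 \<le> a" "0 < \<kappa>"
  shows "\<exists>E\<in>events. prob E \<le> exp \<rho> * (1 + 2 * a * (c\<^sup>2 * card D * s\<^sup>2)) powr
        (- (real (card I) - real (card T)) / 2) \<and>
    {\<omega> \<in> space M. \<exists>b. ridge a \<kappa> I T (\<lambda>i j. X (i, j) \<omega>) (\<lambda>i. c * (\<Sum>j\<in>D. X (i, j) \<omega>)) b \<le> \<rho>} \<subseteq> E"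
proof -
  define V where "V i \<omega> = c * (\<Sum>j\<in>D. X (i, j) \<omega>)" for i \<omega>
  define s' where "s' = c * sqrt (\<Sum>j\<in>D. s\<^sup>2)"
  have s': "s' > 0" "s'\<^sup>2 = c\<^sup>2 * card D * s\<^sup>2"
    using pos fin DT by (auto simp: s'_def power_mult_distrib card_gt_0_iff)
  have Xm [measurable]: "X x \<in> borel_measurable M" if "x \<in> I \<times> (D \<union> T)" for x
    using ind that by (auto simp: indep_vars_def)
  have V: "distributed M lborel (V i) (normal_density 0 s')" if i: "i \<in> I" for i
  proof -
    have "distributed M lborel (\<lambda>\<omega>. \<Sum>j\<in>D. X (i, j) \<omega>) (normal_density (\<Sum>j\<in>D. 0) (sqrt (\<Sum>j\<in>D. s\<^sup>2)))"
    proof (intro sum_indep_normal fin DT pos)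
      show "indep_vars (\<lambda>_. borel) (\<lambda>j. X (i, j)) D"
        using i by (intro indep_vars_reindex_inj[OF ind]) (auto simp: inj_on_def)
      show "distributed M lborel (X (i, j)) (normal_density 0 s)" if "j \<in> D" for j
        using that i pos by (auto simp: distributed_normal_iff_distr law intro!: Xm)
    qed
    from normal_density_affine[OF this, of c 0] show ?thesis
      using pos fin DT by (auto simp: V_def[abs_def] s'_def card_gt_0_iff)
  qed
  have indV: "indep_vars (\<lambda>_. borel) V I"
  proof -
    have "indep_vars (\<lambda>i. PiM ({i} \<times> D) (\<lambda>_. borel)) (\<lambda>i \<omega>. restrict (\<lambda>x. X x \<omega>) ({i} \<times> D)) I"
      by (intro indep_vars_restrict[OF ind]) (auto simp: disjoint_family_on_def)
    from indep_vars_compose2[OF this, where Y = "\<lambda>i h. c * (\<Sum>j\<in>D. h (i, j))" and N = "\<lambda>_. borel"]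
    show ?thesis by (simp add: V_def[abs_def])
  qed
  let ?N = "PiM (I \<times> T) (\<lambda>_. borel :: real measure)" and ?U = "PiM (I \<times> D) (\<lambda>_. borel :: real measure)"
  let ?Q = "PiM I (\<lambda>_. borel :: real measure)"
  \<comment> \<open>\<open>Z\<close> collects the columns in \<open>T\<close> and \<open>U\<close>
    those in \<open>D\<close>. The vector \<open>V\<close> is a function \<open>g\<close> of
    \<open>U\<close>, so the product law of the pair \<open>(Z, U)\<close> is pushed forward along
    \<open>g\<close> below.\<close>
  define Z U g where "Z \<omega> = restrict (\<lambda>x. X x \<omega>) (I \<times> T)" and "U \<omega> = restrict (\<lambda>x. X x \<omega>) (I \<times> D)"
    and "g h = (\<lambda>i\<in>I. c * (\<Sum>j\<in>D. h (i, j)))" for \<omega> and h :: "'i \<times> 'j \<Rightarrow> real"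
  have ZU: "indep_var ?N Z ?U U"
    unfolding Z_def U_def using DT by (intro indep_var_restrict[OF ind]) auto
  hence [measurable]: "Z \<in> measurable M ?N" "U \<in> measurable M ?U"
    by (blast dest: indep_var_rv1 indep_var_rv2)+
  have g [measurable]: "g \<in> measurable ?U ?Q"
    unfolding g_def by measurable
  have gU: "(\<lambda>i\<in>I. V i \<omega>) = g (U \<omega>)" for \<omega>
    by (auto simp: g_def U_def V_def fun_eq_iff intro!: sum.cong)
  have prod: "distr M ?N Z \<Otimes>\<^sub>M distr M ?Q (\<lambda>\<omega>. \<lambda>i\<in>I. V i \<omega>) =
      distr M (?N \<Otimes>\<^sub>M ?Q) (\<lambda>\<omega>. (Z \<omega>, \<lambda>i\<in>I. V i \<omega>))"
  proof -
    have eq: "distr M ?N Z \<Otimes>\<^sub>M distr M ?U U = distr M (?N \<Otimes>\<^sub>M ?U) (\<lambda>\<omega>. (Z \<omega>, U \<omega>))"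
      using ZU by (simp add: indep_var_distribution_eq)
    have "distr M ?N Z \<Otimes>\<^sub>M distr M ?Q (\<lambda>\<omega>. g (U \<omega>)) =
      distr (distr M ?N Z) ?N (\<lambda>x. x) \<Otimes>\<^sub>M distr (distr M ?U U) ?Q g"
      by (simp add: distr_distr comp_def)
    also have "\<dots> = distr (distr M ?N Z \<Otimes>\<^sub>M distr M ?U U) (?N \<Otimes>\<^sub>M ?Q) (\<lambda>(x, y). (x, g y))"
    proof (rule pair_measure_distr)
      have "prob_space (distr (distr M ?U U) ?Q g)"
        by (intro prob_space.prob_space_distr prob_space_distr) auto
      thus "sigma_finite_measure (distr (distr M ?U U) ?Q g)"
        by (rule prob_space_imp_sigma_finite)
    qed auto
    also have "\<dots> = distr M (?N \<Otimes>\<^sub>M ?Q) (\<lambda>\<omega>. (Z \<omega>, g (U \<omega>)))"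
      unfolding eq by (subst distr_distr) (auto simp: comp_def)
    finally show ?thesis unfolding gU .
  qed
  have "\<exists>E\<in>events. prob E \<le> exp \<rho> * (1 + 2 * a * s'\<^sup>2) powr (- (real (card I) - real (card T)) / 2) \<and>
    {\<omega> \<in> space M. \<exists>b. ridge a \<kappa> I T ((\<lambda>z i j. z (i, j)) (Z \<omega>)) (\<lambda>i. V i \<omega>) b \<le> \<rho>} \<subseteq> E"
  proof (intro gaussian_small_ball[where N = ?N] fin indV s' pos prod)
    show "distr M borel (V i) = normal_law 0 s'" if "i \<in> I" for i
      using V[OF that] s' by (simp add: distributed_normal_iff_distr)
  qed auto
  moreover have "ridge a \<kappa> I T ((\<lambda>z i j. z (i, j)) (Z \<omega>)) (\<lambda>i. V i \<omega>) b =
      ridge a \<kappa> I T (\<lambda>i j. X (i, j) \<omega>) (\<lambda>i. c * (\<Sum>j\<in>D. X (i, j) \<omega>)) b" for \<omega> b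
    by (simp add: ridge_def Z_def V_def)
  ultimately show ?thesis unfolding s'(2) by simp
qed

text \<open>A union bound over at most \<open>4 ^ card J\<close> pairs. Quantifying over all pairs
  outside one event lets the bound be applied later to supports that depend on \<open>X\<close>,
  such as that of the estimator.\<close>

lemma (in prob_space) gaussian_matrix_small_ball_uniform:
  fixes X :: "'i \<times> 'j \<Rightarrow> 'a \<Rightarrow> real" and a c d s t \<kappa> \<rho> :: real
  assumes fin: "finite I" "finite J"
    and ind: "indep_vars (\<lambda>_. borel) X (I \<times> J)"
    and law: "\<And>i j. i \<in> I \<Longrightarrow> j \<in> J \<Longrightarrow> distr M borel (X (i, j)) = normal_law 0 s"
    and pos: "0 < s" "0 < c" "0 \<le> a" "0 < \<kappa>" "0 < d" "t \<le> card I"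
  shows "\<exists>E\<in>events. prob E \<le> 4 ^ card J * (exp \<rho> * (1 + 2 * a * (c\<^sup>2 * d * s\<^sup>2)) powr (- (real (card I) - t) / 2)) \<and>
    (\<forall>\<omega>\<in>space M - E. \<forall>S\<subseteq>J. \<forall>T\<subseteq>J. \<forall>b. d \<le> card (S - T) \<longrightarrow> card T \<le> t \<longrightarrow>
      \<rho> < ridge a \<kappa> I T (\<lambda>i j. X (i, j) \<omega>) (\<lambda>i. c * (\<Sum>j\<in>S - T. X (i, j) \<omega>)) b)"
proof -
  define B where "B = exp \<rho> * (1 + 2 * a * (c\<^sup>2 * d * s\<^sup>2)) powr (- (real (card I) - t) / 2)"
  define Ad where "Ad = {(S, T). S \<subseteq> J \<and> T \<subseteq> J \<and> d \<le> card (S - T) \<and> card T \<le> t}"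
  have sub: "Ad \<subseteq> Pow J \<times> Pow J" by (auto simp: Ad_def)
  hence finAd: "finite Ad" using fin by (auto intro: finite_subset)
  have "card Ad \<le> card (Pow J \<times> Pow J)" using sub fin by (intro card_mono) auto
  also have "\<dots> = 4 ^ card J" using fin by (simp add: card_cartesian_product card_Pow flip: power_mult_distrib)
  finally have cardAd: "card Ad \<le> 4 ^ card J" .
  have ex: "\<exists>E\<in>events. prob E \<le> B \<and>
    {\<omega> \<in> space M. \<exists>b. ridge a \<kappa> I T (\<lambda>i j. X (i, j) \<omega>) (\<lambda>i. c * (\<Sum>j\<in>S - T. X (i, j) \<omega>)) b \<le> \<rho>} \<subseteq> E"
    if "(S, T) \<in> Ad" for S T
  proof -
    have ST: "S \<subseteq> J" "T \<subseteq> J" "d \<le> card (S - T)" "card T \<le> t" using that by (auto simp: Ad_def)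
    have f: "finite (S - T)" "finite T" using ST fin by (auto intro: finite_subset)
    have "S - T \<noteq> {}" using ST pos by (metis card.empty not_le of_nat_0)
    hence "\<exists>E\<in>events. prob E \<le> exp \<rho> * (1 + 2 * a * (c\<^sup>2 * card (S - T) * s\<^sup>2)) powr
        (- (real (card I) - real (card T)) / 2) \<and>
      {\<omega> \<in> space M. \<exists>b. ridge a \<kappa> I T (\<lambda>i j. X (i, j) \<omega>) (\<lambda>i. c * (\<Sum>j\<in>S - T. X (i, j) \<omega>)) b \<le> \<rho>} \<subseteq> E"
      using ST fin f pos
      by (intro gaussian_matrix_small_ball[OF fin(1) f] indep_vars_subset[OF ind] law) auto
    \<comment> \<open>Replacing \<open>card (S - T)\<close> by \<open>d\<close> and
      \<open>card T\<close> by \<open>t\<close> only enlarges the bound: the base is at least one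
      and the exponent is nonpositive because \<open>t \<le> card I\<close>.\<close>
    moreover have "exp \<rho> * (1 + 2 * a * (c\<^sup>2 * card (S - T) * s\<^sup>2)) powr
        (- (real (card I) - real (card T)) / 2) \<le> B"
    proof -
      let ?q = "1 + 2 * a * (c\<^sup>2 * d * s\<^sup>2)" and ?q' = "1 + 2 * a * (c\<^sup>2 * card (S - T) * s\<^sup>2)"
      have q: "1 \<le> ?q" using pos by simp
      have qq: "?q \<le> ?q'" using pos ST by (intro add_left_mono mult_left_mono mult_right_mono) auto
      have "?q' powr (- (real (card I) - real (card T)) / 2) \<le> ?q powr (- (real (card I) - real (card T)) / 2)"
        using ST pos by (intro powr_mono2' less_le_trans[OF zero_less_one q] qq) auto
      also have "\<dots> \<le> ?q powr (- (real (card I) - t) / 2)"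
        using q ST pos by (intro powr_mono) auto
      finally show ?thesis unfolding B_def by simp
    qed
    ultimately show ?thesis by (elim bexE) (rule bexI, auto)
  qed
  define E where "E = (\<lambda>(S, T). SOME E. E \<in> events \<and> prob E \<le> B \<and>
    {\<omega> \<in> space M. \<exists>b. ridge a \<kappa> I T (\<lambda>i j. X (i, j) \<omega>) (\<lambda>i. c * (\<Sum>j\<in>S - T. X (i, j) \<omega>)) b \<le> \<rho>} \<subseteq> E)"
  have E: "E (S, T) \<in> events \<and> prob (E (S, T)) \<le> B \<and>
    {\<omega> \<in> space M. \<exists>b. ridge a \<kappa> I T (\<lambda>i j. X (i, j) \<omega>) (\<lambda>i. c * (\<Sum>j\<in>S - T. X (i, j) \<omega>)) b \<le> \<rho>} \<subseteq> E (S, T)"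
    if "(S, T) \<in> Ad" for S T
    unfolding E_def prod.case by (rule someI_ex) (use ex[OF that] in blast)
  have Eev: "E x \<in> events" and EB: "prob (E x) \<le> B" if "x \<in> Ad" for x
    using E that by (cases x; auto)+
  have "prob (\<Union>x\<in>Ad. E x) \<le> (\<Sum>x\<in>Ad. prob (E x))"
    using finAd Eev by (intro finite_measure_subadditive_finite) auto
  also have "\<dots> \<le> (\<Sum>x\<in>Ad. B)" by (intro sum_mono EB)
  also have "\<dots> = card Ad * B" by simp
  also have "\<dots> \<le> 4 ^ card J * B"
  proof -
    have "real (card Ad) \<le> real (4 ^ card J)" using cardAd by (simp only: of_nat_le_iff)
    thus ?thesis unfolding B_def by (intro mult_right_mono) auto
  qed
  finally have "prob (\<Union>x\<in>Ad. E x) \<le> 4 ^ card J * B" .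
  moreover have "(\<Union>x\<in>Ad. E x) \<in> events" using finAd Eev by auto
  moreover have "\<rho> < ridge a \<kappa> I T (\<lambda>i j. X (i, j) \<omega>) (\<lambda>i. c * (\<Sum>j\<in>S - T. X (i, j) \<omega>)) b"
    if "\<omega> \<in> space M - (\<Union>x\<in>Ad. E x)" "S \<subseteq> J" "T \<subseteq> J" "d \<le> card (S - T)" "card T \<le> t" for \<omega> S T b
  proof (rule ccontr)
    assume "\<not> ?thesis"
    moreover have A: "(S, T) \<in> Ad" using that by (auto simp: Ad_def)
    ultimately have "\<omega> \<in> E (S, T)" using E[OF A] that by (auto simp: not_less)
    thus False using that A by auto
  qed
  ultimately show ?thesis unfolding B_def by blast
qed

text \<open>Chernoff's bound at the exponent \<open>u = 1 / (4 * s\<^sup>2)\<close>: the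
  one-dimensional Gaussian integral with \<open>a = - u\<close> equals \<open>sqrt 2\<close>, and
  the threshold contributes \<open>exp (- 1)\<close> per coordinate. The resulting ratio is below
  one.\<close>

lemma (in prob_space) prob_sum_squares_normal_ge_pos:
  fixes z :: "'i \<Rightarrow> 'a \<Rightarrow> real" and s :: real
  assumes fin: "finite I" and ind: "indep_vars (\<lambda>_. borel) z I"
    and law: "\<And>i. i \<in> I \<Longrightarrow> distr M borel (z i) = normal_law 0 s" and s: "0 < s"
  shows "prob {\<omega> \<in> space M. (\<Sum>i\<in>I. (z i \<omega>)\<^sup>2) \<ge> 4 * s\<^sup>2 * card I} \<le> (sqrt 2 / exp 1) ^ card I"
proof -
  have [measurable]: "i \<in> I \<Longrightarrow> z i \<in> borel_measurable M" for i
    using ind by (auto simp: indep_vars_def)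
  define u where "u = 1 / (4 * s\<^sup>2)"
  have u: "u > 0" "u * (4 * s\<^sup>2 * card I) = card I" using s by (auto simp: u_def)
  have one: "(\<integral>\<^sup>+\<omega>. ennreal (exp (u * (z i \<omega>)\<^sup>2)) \<partial>M) = ennreal (sqrt 2)" if "i \<in> I" for i
  proof -
    have "(\<integral>\<^sup>+\<omega>. ennreal (exp (u * (z i \<omega>)\<^sup>2)) \<partial>M) = (\<integral>\<^sup>+x. ennreal (exp (- (- u * (x - 0)\<^sup>2))) \<partial>distr M borel (z i))"
      using that by (subst nn_integral_distr) auto
    also have "\<dots> = ennreal ((1 + 2 * - u * s\<^sup>2) powr (- 1 / 2) * exp (- (- u / (1 + 2 * - u * s\<^sup>2) * 0\<^sup>2)))"
      unfolding law[OF that] using s by (intro nn_integral_exp_square_normal) (auto simp: u_def)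
    also have "1 + 2 * - u * s\<^sup>2 = 1 / 2" using s by (simp add: u_def)
    also have "(1 / 2 :: real) powr (- 1 / 2) = sqrt 2"
      using powr_minus_divide[of "1/2 :: real" "1/2"] by (simp add: powr_half_sqrt real_sqrt_divide)
    finally show ?thesis by simp
  qed
  have "emeasure M {\<omega> \<in> space M. (\<Sum>i\<in>I. (z i \<omega>)\<^sup>2) \<ge> 4 * s\<^sup>2 * card I} \<le>
    ennreal (exp (- u * (4 * s\<^sup>2 * card I))) *
      (\<integral>\<^sup>+\<omega>. ennreal (exp (u * (\<Sum>i\<in>I. (z i \<omega>)\<^sup>2))) * indicator (space M) \<omega> \<partial>M)"
    using u by (intro Chernoff_ineq_nn_integral_ge) auto
  also have "(\<integral>\<^sup>+\<omega>. ennreal (exp (u * (\<Sum>i\<in>I. (z i \<omega>)\<^sup>2))) * indicator (space M) \<omega> \<partial>M) =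
     (\<integral>\<^sup>+\<omega>. (\<Prod>i\<in>I. ennreal (exp (u * (z i \<omega>)\<^sup>2))) \<partial>M)"
    using fin by (intro nn_integral_cong) (simp add: sum_distrib_left exp_sum prod_ennreal)
  also have "\<dots> = (\<Prod>i\<in>I. \<integral>\<^sup>+\<omega>. ennreal (exp (u * (z i \<omega>)\<^sup>2)) \<partial>M)"
    using fin by (subst indep_vars_nn_integral[OF _ indep_vars_compose2[OF ind]]) auto
  also have "\<dots> = ennreal (sqrt 2 ^ card I)"
    by (simp add: one ennreal_power)
  also have "- u * (4 * s\<^sup>2 * card I) = - real (card I)" using u(2) by linarith
  also have "exp (- real (card I)) = exp (- 1) ^ card I"
    using exp_of_nat_mult[of "card I" "- 1 :: real"] by simp
  also have "ennreal (exp (- 1) ^ card I) * ennreal (sqrt 2 ^ card I) = ennreal ((sqrt 2 / exp 1) ^ card I)"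
  proof -
    have "exp (- 1) ^ card I * sqrt 2 ^ card I = (sqrt 2 / exp 1 :: real) ^ card I"
      unfolding power_mult_distrib[symmetric] by (simp add: exp_minus divide_inverse mult.commute)
    thus ?thesis by (subst ennreal_mult[symmetric]) auto
  qed
  finally show ?thesis by (simp add: emeasure_eq_measure)
qed

subsection \<open>Concentration and deterministic bounds\<close>

text \<open>The extra 1 in the threshold makes it positive when \<open>s = 0\<close>, where the sum
  vanishes almost surely; for positive \<open>s\<close> it only shrinks the event.\<close>

lemma (in prob_space) prob_sum_squares_normal_ge:
  fixes z :: "'i \<Rightarrow> 'a \<Rightarrow> real" and s :: real
  assumes fin: "finite I" "I \<noteq> {}" and ind: "indep_vars (\<lambda>_. borel) z I"
    and law: "\<And>i. i \<in> I \<Longrightarrow> distr M borel (z i) = normal_law 0 s" and s: "0 \<le> s"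
  shows "prob {\<omega> \<in> space M. (\<Sum>i\<in>I. (z i \<omega>)\<^sup>2) \<ge> (4 * s\<^sup>2 + 1) * card I} \<le> (sqrt 2 / exp 1) ^ card I"
proof (cases "s = 0")
  case True
  have [measurable]: "i \<in> I \<Longrightarrow> z i \<in> borel_measurable M" for i
    using ind by (auto simp: indep_vars_def)
  have "AE \<omega> in M. z i \<omega> = 0" if "i \<in> I" for i
  proof -
    have "AE x in distr M borel (z i). x = 0"
      unfolding law[OF that] True normal_law_def if_P[OF refl] by (subst AE_return) auto
    thus ?thesis using that by (subst (asm) AE_distr_iff) auto
  qed
  hence "AE \<omega> in M. \<forall>i\<in>I. z i \<omega> = 0" using fin by (intro AE_finite_allI) auto
  hence "AE \<omega> in M. \<omega> \<notin> {\<omega> \<in> space M. (\<Sum>i\<in>I. (z i \<omega>)\<^sup>2) \<ge> (4 * s\<^sup>2 + 1) * card I}"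
  proof eventually_elim
    case (elim \<omega>)
    thus ?case using fin by (auto simp: True card_gt_0_iff not_le)
  qed
  hence "prob {\<omega> \<in> space M. (\<Sum>i\<in>I. (z i \<omega>)\<^sup>2) \<ge> (4 * s\<^sup>2 + 1) * card I} = 0"
    by (subst prob_eq_0) auto
  thus ?thesis by simp
next
  case False
  have [measurable]: "i \<in> I \<Longrightarrow> z i \<in> borel_measurable M" for i
    using ind by (auto simp: indep_vars_def)
  have "prob {\<omega> \<in> space M. (\<Sum>i\<in>I. (z i \<omega>)\<^sup>2) \<ge> (4 * s\<^sup>2 + 1) * card I} \<le>
    prob {\<omega> \<in> space M. (\<Sum>i\<in>I. (z i \<omega>)\<^sup>2) \<ge> 4 * s\<^sup>2 * card I}"
    by (intro finite_measure_mono) (auto simp: algebra_simps)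
  also have "\<dots> \<le> (sqrt 2 / exp 1) ^ card I"
    using False s by (intro prob_sum_squares_normal_ge_pos fin ind law) auto
  finally show ?thesis .
qed

section \<open>The random support of the signal\<close>

lemma (in prob_space) AE_two_point_prior:
  fixes X :: "'a \<Rightarrow> real" and \<epsilon> m :: real
  assumes [measurable]: "X \<in> borel_measurable M" and "distr M borel X = two_point_prior \<epsilon> m"
  shows "AE \<omega> in M. X \<omega> \<in> {0, m}"
proof -
  have "AE x in distr M borel X. x \<in> {0, m}"
    unfolding assms two_point_prior_def by (subst AE_distr_iff) auto
  thus ?thesis by (subst (asm) AE_distr_iff) auto
qed

lemma (in prob_space) expectation_two_point_prior_nonzero:
  fixes X :: "'a \<Rightarrow> real" and \<epsilon> m :: real
  assumes [measurable]: "X \<in> borel_measurable M" and "distr M borel X = two_point_prior \<epsilon> m"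
    and "0 \<le> \<epsilon>" "\<epsilon> \<le> 1" "m \<noteq> 0"
  shows "expectation (\<lambda>\<omega>. of_bool (X \<omega> \<noteq> 0)) = \<epsilon>"
proof -
  have "expectation (\<lambda>\<omega>. of_bool (X \<omega> \<noteq> 0) :: real) = (\<integral>x. of_bool (x \<noteq> 0) \<partial>distr M borel X)"
    by (subst integral_distr) auto
  also have "\<dots> = \<epsilon>"
    unfolding assms two_point_prior_def using assms by (subst integral_distr) auto
  finally show ?thesis .
qed

text \<open>Hoeffding's inequality for the indicators of
  \<open>\<beta> j \<omega> \<noteq> 0\<close>, which have mean \<open>\<epsilon>\<close> and range
  \<open>[0, 1]\<close>.\<close>

lemma (in prob_space) prob_card_nonzero_deviation:
  fixes \<beta> :: "'j \<Rightarrow> 'a \<Rightarrow> real" and \<epsilon> \<tau> m :: real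
  assumes fin: "finite J" "J \<noteq> {}" and ind: "indep_vars (\<lambda>_. borel) \<beta> J"
    and law: "\<And>j. j \<in> J \<Longrightarrow> distr M borel (\<beta> j) = two_point_prior \<epsilon> m"
    and \<epsilon>: "0 \<le> \<epsilon>" "\<epsilon> \<le> 1" "m \<noteq> 0" and \<tau>: "0 \<le> \<tau>"
  shows "prob {\<omega> \<in> space M. \<bar>card {j\<in>J. \<beta> j \<omega> \<noteq> 0} - \<epsilon> * card J\<bar> \<ge> \<tau> * card J} \<le>
    2 * exp (- 2 * \<tau>\<^sup>2 * card J)"
proof -
  have [measurable]: "j \<in> J \<Longrightarrow> \<beta> j \<in> borel_measurable M" for j
    using ind by (auto simp: indep_vars_def)
  define Y :: "_ \<Rightarrow> _ \<Rightarrow> real" where "Y j \<omega> = of_bool (\<beta> j \<omega> \<noteq> 0)" for j \<omega>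
  have Yind: "indep_vars (\<lambda>_. borel) Y J"
    unfolding Y_def[abs_def]
    by (rule indep_vars_compose2[OF ind, where Y = "\<lambda>_ x. of_bool (x \<noteq> 0)" and N = "\<lambda>_. borel"]) auto
  define \<mu> where "\<mu> = (\<Sum>j\<in>J. expectation (Y j))"
  interpret H: Hoeffding_ineq M J Y "\<lambda>_. 0" "\<lambda>_. 1" \<mu>
    by unfold_locales (use fin Yind in \<open>auto simp: Y_def \<mu>_def\<close>)
  have \<mu>: "\<mu> = \<epsilon> * card J"
    unfolding \<mu>_def Y_def using \<epsilon> by (simp add: expectation_two_point_prior_nonzero[OF _ law])
  have "(\<Sum>j\<in>J. Y j \<omega>) = card {j\<in>J. \<beta> j \<omega> \<noteq> 0}" for \<omega>
    using fin by (simp add: Y_def sum.If_cases of_bool_def Int_def)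
  hence "prob {\<omega> \<in> space M. \<bar>card {j\<in>J. \<beta> j \<omega> \<noteq> 0} - \<epsilon> * card J\<bar> \<ge> \<tau> * card J} \<le>
    2 * exp (- 2 * (\<tau> * card J)\<^sup>2 / (\<Sum>j\<in>J. (1 - 0)\<^sup>2))"
    using H.Hoeffding_ineq_abs_ge[of "\<tau> * card J"] fin \<tau> by (simp add: \<mu> card_gt_0_iff)
  also have "- 2 * (\<tau> * card J)\<^sup>2 / (\<Sum>j\<in>J. (1 - 0)\<^sup>2) = - 2 * \<tau>\<^sup>2 * card J"
    using fin by (simp add: power2_eq_square)
  finally show ?thesis .
qed

text \<open>The events \<open>W > N + 1\<close> decrease to the empty set because \<open>W\<close>
  is finite everywhere. This picks a ridge weight for which the penalty of a given random
  coefficient vector is at most one outside a set of small probability.\<close>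

lemma (in prob_space) exists_scale_prob_less:
  fixes W :: "'a \<Rightarrow> real" and \<theta> :: real
  assumes [measurable]: "W \<in> borel_measurable M" and "0 < \<theta>"
  shows "\<exists>\<kappa>>0. prob {\<omega> \<in> space M. 1 < \<kappa> * W \<omega>} < \<theta>"
proof -
  define B where "B = (\<lambda>N. {\<omega> \<in> space M. real (Suc N) < W \<omega>})"
  have "(\<lambda>N. prob (B N)) \<longlonglongrightarrow> prob (\<Inter>N. B N)"
    by (intro finite_Lim_measure_decseq) (auto simp: B_def decseq_def)
  moreover have "(\<Inter>N. B N) = {}"
  proof -
    have "\<exists>N. W \<omega> \<le> real (Suc N)" for \<omega>
    proof -
      obtain N where "W \<omega> \<le> real N" using real_arch_simple by blast
      thus ?thesis by (intro exI[of _ N]) simp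
    qed
    thus ?thesis by (auto simp: B_def not_less) (meson not_le)
  qed
  ultimately have "(\<lambda>N. prob (B N)) \<longlonglongrightarrow> 0" by simp
  hence "eventually (\<lambda>N. prob (B N) < \<theta>) sequentially"
    using assms(2) by (rule order_tendstoD)
  then obtain N where N: "prob (B N) < \<theta>" by (auto simp: eventually_sequentially)
  have "B N = {\<omega> \<in> space M. 1 < 1 / real (Suc N) * W \<omega>}"
    by (auto simp: B_def field_simps)
  with N show ?thesis by (intro exI[of _ "1 / real (Suc N)"]) simp
qed

text \<open>Minimality is used only against the true \<open>\<beta>\<close>. The first bound drops
  the residual of the estimator. For the second, residual minus noise equals \<open>X\<close>
  applied to \<open>\<beta> - bhat\<close>; on \<open>S - T\<close> its coefficients are
  \<open>m\<close> since \<open>bhat\<close> vanishes there, and the rest lies in the span of the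
  columns in \<open>T\<close>.\<close>

lemma l0_minimizer_bounds:
  fixes X :: "nat \<Rightarrow> nat \<Rightarrow> real" and lam m :: real
  assumes min: "is_arg_min (l0_objective n p X y lam) (\<lambda>_. True) bhat"
    and y: "\<And>i. i < n \<Longrightarrow> y i = mat_vec p X \<beta> i + z i"
    and \<beta>: "\<And>j. j < p \<Longrightarrow> \<beta> j \<in> {0, m}" and lam: "0 \<le> lam"
  defines "S \<equiv> {j. j < p \<and> \<beta> j \<noteq> 0}" and "T \<equiv> {j. j < p \<and> bhat j \<noteq> 0}"
  shows "lam * card T \<le> (\<Sum>i<n. (z i)\<^sup>2) + lam * card S"
    and "(\<Sum>i<n. (m * (\<Sum>j\<in>S - T. X i j) - (\<Sum>j\<in>T. X i j * (bhat j - \<beta> j)))\<^sup>2) \<le>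
      4 * (\<Sum>i<n. (z i)\<^sup>2) + 2 * lam * card S"
proof -
  define r where "r i = y i - mat_vec p X bhat i" for i
  have [simp]: "finite S" "finite T" by (auto simp: S_def T_def)
  have L2: "(L2_set f {..<n})\<^sup>2 = (\<Sum>i<n. (f i)\<^sup>2)" for f
    by (simp add: L2_set_def sum_nonneg)
  have "l0_objective n p X y lam bhat \<le> l0_objective n p X y lam \<beta>"
    using min by (auto simp: is_arg_min_def not_less)
  moreover have "(\<Sum>i<n. (y i - mat_vec p X \<beta> i)\<^sup>2) = (\<Sum>i<n. (z i)\<^sup>2)"
    by (intro sum.cong) (auto simp: y)
  ultimately have obj: "(\<Sum>i<n. (r i)\<^sup>2) + lam * card T \<le> (\<Sum>i<n. (z i)\<^sup>2) + lam * card S"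
    by (simp add: l0_objective_def L2 r_def l0_norm_def S_def T_def)
  have "0 \<le> (\<Sum>i<n. (r i)\<^sup>2)" by (simp add: sum_nonneg)
  with obj show "lam * card T \<le> (\<Sum>i<n. (z i)\<^sup>2) + lam * card S" by linarith
  have "0 \<le> lam * card T" using lam by simp
  with obj have r: "(\<Sum>i<n. (r i)\<^sup>2) \<le> (\<Sum>i<n. (z i)\<^sup>2) + lam * card S" by linarith
  have res: "m * (\<Sum>j\<in>S - T. X i j) - (\<Sum>j\<in>T. X i j * (bhat j - \<beta> j)) = r i - z i" if "i < n" for i
  proof -
    have "mat_vec p X \<beta> i = (\<Sum>j\<in>S \<union> T. X i j * \<beta> j)"
      unfolding mat_vec_def by (intro sum.mono_neutral_right) (auto simp: S_def T_def)
    also have "S \<union> T = (S - T) \<union> T" by auto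
    also have "(\<Sum>j\<in>\<dots>. X i j * \<beta> j) = (\<Sum>j\<in>S - T. X i j * \<beta> j) + (\<Sum>j\<in>T. X i j * \<beta> j)"
      by (intro sum.union_disjoint) auto
    also have "(\<Sum>j\<in>S - T. X i j * \<beta> j) = m * (\<Sum>j\<in>S - T. X i j)"
      unfolding sum_distrib_left using \<beta> by (intro sum.cong) (auto simp: S_def)
    finally have 1: "mat_vec p X \<beta> i = m * (\<Sum>j\<in>S - T. X i j) + (\<Sum>j\<in>T. X i j * \<beta> j)" .
    have 2: "mat_vec p X bhat i = (\<Sum>j\<in>T. X i j * bhat j)"
      unfolding mat_vec_def by (intro sum.mono_neutral_right) (auto simp: T_def)
    show ?thesis
      unfolding r_def y[OF that] 1 2 by (simp add: algebra_simps sum_subtractf)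
  qed
  have "(\<Sum>i<n. (m * (\<Sum>j\<in>S - T. X i j) - (\<Sum>j\<in>T. X i j * (bhat j - \<beta> j)))\<^sup>2) =
      (\<Sum>i<n. (r i - z i)\<^sup>2)"
    by (intro sum.cong refl) (simp add: res)
  also have "\<dots> \<le> (\<Sum>i<n. 2 * (r i)\<^sup>2 + 2 * (z i)\<^sup>2)"
  proof (intro sum_mono)
    fix i
    have "0 \<le> (r i + z i)\<^sup>2" by simp
    thus "(r i - z i)\<^sup>2 \<le> 2 * (r i)\<^sup>2 + 2 * (z i)\<^sup>2" by (simp add: power2_eq_square algebra_simps)
  qed
  also have "\<dots> = 2 * (\<Sum>i<n. (r i)\<^sup>2) + 2 * (\<Sum>i<n. (z i)\<^sup>2)"
    by (simp add: sum.distrib sum_distrib_left)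
  also have "\<dots> \<le> 4 * (\<Sum>i<n. (z i)\<^sup>2) + 2 * lam * card S" using r by simp
  finally show "(\<Sum>i<n. (m * (\<Sum>j\<in>S - T. X i j) - (\<Sum>j\<in>T. X i j * (bhat j - \<beta> j)))\<^sup>2) \<le>
      4 * (\<Sum>i<n. (z i)\<^sup>2) + 2 * lam * card S" .
qed

text \<open>Since \<open>card (T - S) = card T - card S + card (S - T)\<close>, there are at most
  \<open>2 * d\<close> false discoveries, while
  \<open>card T \<ge> card S - d \<ge> card S / 2\<close>. Hence the false discovery proportion is
  at most \<open>4 * d / card S\<close>.\<close>

lemma FDP_TPP_bounds:
  fixes b \<beta> :: "nat \<Rightarrow> real" and d \<eta> :: real and p :: nat
  defines "S \<equiv> {j. j < p \<and> \<beta> j \<noteq> 0}" and "T \<equiv> {j. j < p \<and> b j \<noteq> 0}"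
  assumes ST: "card (S - T) \<le> d" and T: "card T \<le> card S + d"
    and d: "0 < d" "4 * d \<le> \<eta> * card S" "2 * d \<le> card S"
  shows "\<bar>FDP p b \<beta>\<bar> \<le> \<eta>" and "\<bar>TPP p b \<beta> - 1\<bar> \<le> \<eta>"
proof -
  have fin [simp]: "finite S" "finite T" by (auto simp: S_def T_def)
  have S: "real (card S) = card (S \<inter> T) + card (S - T)"
    by (metis card_Int_Diff fin(1) of_nat_add)
  have T': "real (card T) = card (S \<inter> T) + card (T - S)"
    by (metis card_Int_Diff fin(2) of_nat_add Int_commute)
  have Spos: "card S > 0" using d by (intro gr0I) auto
  have e1: "{j. j < p \<and> b j \<noteq> 0 \<and> \<beta> j = 0} = T - S" and e2: "{j. j < p \<and> b j \<noteq> 0 \<and> \<beta> j \<noteq> 0} = S \<inter> T"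
    by (auto simp: S_def T_def)
  have FDP: "FDP p b \<beta> = card (T - S) / max (card T) 1"
    unfolding FDP_def e1 T_def[symmetric] by simp
  have TPP: "TPP p b \<beta> = card (S \<inter> T) / card S"
    unfolding TPP_def e2 S_def[symmetric] using Spos by (simp add: max_def)
  have TS: "card (T - S) \<le> 2 * d" using S T T' ST by linarith
  have Tge: "card S / 2 \<le> real (card T)" using S T' ST d by linarith
  have eta: "\<eta> \<ge> 0" using d by (smt (verit) mult_nonneg_nonneg of_nat_0_le_iff zero_le_mult_iff mult_less_0_iff)
  have "card (T - S) \<le> \<eta> * max (card T) 1"
  proof -
    have "card (T - S) \<le> \<eta> * (card S / 2)" using TS d by linarith
    also have "\<dots> \<le> \<eta> * max (card T) 1" using Tge eta by (intro mult_left_mono) auto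
    finally show ?thesis .
  qed
  thus "\<bar>FDP p b \<beta>\<bar> \<le> \<eta>" unfolding FDP by (simp add: divide_le_eq)
  have "TPP p b \<beta> - 1 = - card (S - T) / card S"
    unfolding TPP using S Spos by (simp add: field_simps)
  hence "\<bar>TPP p b \<beta> - 1\<bar> = card (S - T) / card S" by simp
  also have "\<dots> \<le> \<eta>" using ST d Spos by (simp add: divide_le_eq)
  finally show "\<bar>TPP p b \<beta> - 1\<bar> \<le> \<eta>" .
qed

subsection \<open>Support recovery\<close>

lemma linear_model_indep:
  assumes "linear_model \<Omega> n p \<sigma> Prior X \<beta> z y"
  shows "prob_space.indep_vars \<Omega> (\<lambda>_. borel) (\<lambda>(i, j). X i j) ({..<n} \<times> {..<p})"
    and "prob_space.indep_vars \<Omega> (\<lambda>_. borel) \<beta> {..<p}"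
    and "prob_space.indep_vars \<Omega> (\<lambda>_. borel) z {..<n}"
proof -
  interpret prob_space \<Omega> using assms by (simp add: linear_model_def)
  have ind: "indep_vars (\<lambda>_. borel) (case_sum (\<lambda>(i, j). X i j) (case_sum \<beta> z))
       (({..<n} \<times> {..<p}) <+> ({..<p} <+> {..<n}))"
    using assms by (simp add: linear_model_def)
  have "indep_vars (\<lambda>_. borel) (\<lambda>x. case_sum (\<lambda>(i, j). X i j) (case_sum \<beta> z) (Inl x)) ({..<n} \<times> {..<p})"
    by (rule indep_vars_reindex_inj[OF ind]) auto
  thus "indep_vars (\<lambda>_. borel) (\<lambda>(i, j). X i j) ({..<n} \<times> {..<p})" by simp
  have "indep_vars (\<lambda>_. borel) (\<lambda>x. case_sum (\<lambda>(i, j). X i j) (case_sum \<beta> z) ((Inr \<circ> Inl) x)) {..<p}"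
    by (rule indep_vars_reindex_inj[OF ind]) (auto simp: inj_on_def)
  thus "indep_vars (\<lambda>_. borel) \<beta> {..<p}" by simp
  have "indep_vars (\<lambda>_. borel) (\<lambda>x. case_sum (\<lambda>(i, j). X i j) (case_sum \<beta> z) ((Inr \<circ> Inr) x)) {..<n}"
    by (rule indep_vars_reindex_inj[OF ind]) (auto simp: inj_on_def)
  thus "indep_vars (\<lambda>_. borel) z {..<n}" by simp
qed

text \<open>The exceptional event joins four: \<open>E1\<close> for the support size,
  \<open>E2\<close> for the noise, \<open>E3\<close> for the small ball, and \<open>E4\<close> for
  an estimation error too large for the ridge weight. The conclusion off \<open>E\<close> is almost
  sure, because minimality and the two values of \<open>\<beta>\<close> hold up to null
  sets.\<close>

lemma recovery_event:
  fixes m \<epsilon> \<sigma> \<kappa> \<tau> d t \<eta> :: real and n p :: nat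
  assumes lm: "linear_model \<Omega> n p \<sigma> (two_point_prior \<epsilon> m) X \<beta> z y"
    and est: "l0_estimator \<Omega> n p X y m bhat"
    and pos: "0 < m" "0 < n" "0 < p" "0 < \<kappa>" "0 \<le> \<sigma>" "0 \<le> \<epsilon>" "\<epsilon> \<le> 1" "0 \<le> \<tau>" "0 < d" "0 \<le> \<eta>"
    and noise: "(4 * \<sigma>\<^sup>2 + 1) * n \<le> m * d" "4 * (4 * \<sigma>\<^sup>2 + 1) * n \<le> m * p"
    and t: "(\<epsilon> + \<tau>) * p + d \<le> t" "t \<le> n"
    and d: "4 * d \<le> \<eta> * ((\<epsilon> - \<tau>) * p)" "2 * d \<le> (\<epsilon> - \<tau>) * p"
  shows "\<exists>E\<in>sets \<Omega>. measure \<Omega> E \<le> 2 * exp (- 2 * \<tau>\<^sup>2 * p) + (sqrt 2 / exp 1) ^ n +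
      4 ^ p * (exp (3 * p + 1) * (1 + 2 * (m * d / n)) powr (- (real n - t) / 2)) +
      measure \<Omega> {\<omega> \<in> space \<Omega>. 1 < \<kappa> * (\<Sum>j<p. (bhat j \<omega> - \<beta> j \<omega>)\<^sup>2)} \<and>
    (AE \<omega> in \<Omega>. \<omega> \<notin> E \<longrightarrow> \<bar>FDP p (\<lambda>j. bhat j \<omega>) (\<lambda>j. \<beta> j \<omega>)\<bar> \<le> \<eta> \<and>
      \<bar>TPP p (\<lambda>j. bhat j \<omega>) (\<lambda>j. \<beta> j \<omega>) - 1\<bar> \<le> \<eta>)"
proof -
  interpret prob_space \<Omega> using lm by (simp add: linear_model_def)
  note ind = linear_model_indep[OF lm]
  have lawX: "distr \<Omega> borel (X i j) = normal_law 0 (sqrt (1 / real n))" if "i < n" "j < p" for i j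
    using lm that by (simp add: linear_model_def)
  have law\<beta>: "distr \<Omega> borel (\<beta> j) = two_point_prior \<epsilon> m" if "j < p" for j
    using lm that by (simp add: linear_model_def)
  have lawz: "distr \<Omega> borel (z i) = normal_law 0 \<sigma>" if "i < n" for i
    using lm that by (simp add: linear_model_def)
  have [measurable]: "\<beta> j \<in> borel_measurable \<Omega>" if "j < p" for j
    using ind(2) that by (auto simp: indep_vars_def)
  have [measurable]: "z i \<in> borel_measurable \<Omega>" if "i < n" for i
    using ind(3) that by (auto simp: indep_vars_def)
  have [measurable]: "bhat j \<in> borel_measurable \<Omega>" if "j < p" for j
    using est that by (simp add: l0_estimator_def)
  define S where "S \<omega> = {j. j < p \<and> \<beta> j \<omega> \<noteq> 0}" for \<omega>
  define T where "T \<omega> = {j. j < p \<and> bhat j \<omega> \<noteq> 0}" for \<omega>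
  define E1 where "E1 = {\<omega> \<in> space \<Omega>. \<bar>card {j\<in>{..<p}. \<beta> j \<omega> \<noteq> 0} - \<epsilon> * card {..<p}\<bar> \<ge> \<tau> * card {..<p}}"
  define E2 where "E2 = {\<omega> \<in> space \<Omega>. (\<Sum>i<n. (z i \<omega>)\<^sup>2) \<ge> (4 * \<sigma>\<^sup>2 + 1) * card {..<n}}"
  define E4 where "E4 = {\<omega> \<in> space \<Omega>. 1 < \<kappa> * (\<Sum>j<p. (bhat j \<omega> - \<beta> j \<omega>)\<^sup>2)}"
  have "prob E1 \<le> 2 * exp (- 2 * \<tau>\<^sup>2 * card {..<p})"
    unfolding E1_def using pos by (intro prob_card_nonzero_deviation[where m = m] ind law\<beta>) auto
  hence P1: "prob E1 \<le> 2 * exp (- 2 * \<tau>\<^sup>2 * p)" by simp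
  have "prob E2 \<le> (sqrt 2 / exp 1) ^ card {..<n}"
    unfolding E2_def using pos by (intro prob_sum_squares_normal_ge ind lawz) auto
  hence P2: "prob E2 \<le> (sqrt 2 / exp 1) ^ n" by simp
  \<comment> \<open>The weight \<open>a = 1 / m\<close> brings the scaled residual below
    \<open>3 * p\<close>, and the remaining 1 in the level pays for the penalty. With
    \<open>c = m\<close> and entry variance \<open>1 / n\<close> the base becomes
    \<open>1 + 2 * (m * d / n)\<close>.\<close>
  have "\<exists>E\<in>events. prob E \<le> 4 ^ card {..<p} * (exp (3 * p + 1) *
        (1 + 2 * (1 / m) * (m\<^sup>2 * d * (sqrt (1 / n))\<^sup>2)) powr (- (real (card {..<n}) - t) / 2)) \<and>
    (\<forall>\<omega>\<in>space \<Omega> - E. \<forall>S\<subseteq>{..<p}. \<forall>T\<subseteq>{..<p}. \<forall>b. d \<le> card (S - T) \<longrightarrow> card T \<le> t \<longrightarrow>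
      3 * p + 1 < ridge (1 / m) \<kappa> {..<n} T (\<lambda>i j. (case (i, j) of (i, j) \<Rightarrow> X i j) \<omega>)
        (\<lambda>i. m * (\<Sum>j\<in>S - T. (case (i, j) of (i, j) \<Rightarrow> X i j) \<omega>)) b)"
    using pos t by (intro gaussian_matrix_small_ball_uniform ind) (auto simp: lawX)
  then obtain E3 where E3: "E3 \<in> events" "prob E3 \<le> 4 ^ card {..<p} * (exp (3 * p + 1) *
        (1 + 2 * (1 / m) * (m\<^sup>2 * d * (sqrt (1 / n))\<^sup>2)) powr (- (real (card {..<n}) - t) / 2))"
    "\<And>\<omega> S T b. \<omega> \<in> space \<Omega> - E3 \<Longrightarrow> S \<subseteq> {..<p} \<Longrightarrow> T \<subseteq> {..<p} \<Longrightarrow> d \<le> card (S - T) \<Longrightarrow> card T \<le> t \<Longrightarrow>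
      3 * p + 1 < ridge (1 / m) \<kappa> {..<n} T (\<lambda>i j. X i j \<omega>) (\<lambda>i. m * (\<Sum>j\<in>S - T. X i j \<omega>)) b"
    by auto
  have "1 + 2 * (1 / m) * (m\<^sup>2 * d * (sqrt (1 / n))\<^sup>2) = 1 + 2 * (m * d / n)"
    using pos by (simp add: power2_eq_square)
  with E3(2) have P3: "prob E3 \<le> 4 ^ p * (exp (3 * p + 1) * (1 + 2 * (m * d / n)) powr (- (real n - t) / 2))"
    by simp
  have ev: "E1 \<in> events" "E2 \<in> events" "E4 \<in> events"
  proof -
    \<comment> \<open>Writing the cardinality as a sum of indicators makes measurability
      automatic.\<close>
    have "E1 = {\<omega> \<in> space \<Omega>. \<bar>(\<Sum>j<p. of_bool (\<beta> j \<omega> \<noteq> 0)) - \<epsilon> * card {..<p}\<bar> \<ge> \<tau> * card {..<p}}"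
      unfolding E1_def by (simp add: sum.If_cases of_bool_def Int_def)
    also have "\<dots> \<in> events" by measurable
    finally show "E1 \<in> events" .
    show "E2 \<in> events" "E4 \<in> events" unfolding E2_def E4_def by measurable
  qed
  define E where "E = E1 \<union> E2 \<union> E3 \<union> E4"
  have Eev: "E \<in> events" using ev E3 by (simp add: E_def)
  have "prob E \<le> prob E1 + prob E2 + prob E3 + prob E4"
    unfolding E_def using ev E3(1)
    by (intro order_trans[OF measure_Un_le] add_mono order_refl sets.Un) auto
  also have "\<dots> \<le> 2 * exp (- 2 * \<tau>\<^sup>2 * p) + (sqrt 2 / exp 1) ^ n +
      4 ^ p * (exp (3 * p + 1) * (1 + 2 * (m * d / n)) powr (- (real n - t) / 2)) + prob E4"
    using P1 P2 P3 by linarith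
  finally have PE: "prob E \<le> \<dots>" .
  have "AE \<omega> in \<Omega>. \<forall>j\<in>{..<p}. \<beta> j \<omega> \<in> {0, m}"
    by (intro AE_finite_allI AE_two_point_prior) (auto simp: law\<beta>)
  moreover have "AE \<omega> in \<Omega>. is_arg_min
      (l0_objective n p (\<lambda>i j. X i j \<omega>) (\<lambda>i. y i \<omega>) m) (\<lambda>_. True) (\<lambda>j. bhat j \<omega>)"
    using est by (simp add: l0_estimator_def)
  moreover have "AE \<omega> in \<Omega>. \<omega> \<in> space \<Omega>" by (rule AE_space)
  ultimately have "AE \<omega> in \<Omega>. \<omega> \<notin> E \<longrightarrow> \<bar>FDP p (\<lambda>j. bhat j \<omega>) (\<lambda>j. \<beta> j \<omega>)\<bar> \<le> \<eta> \<and>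
      \<bar>TPP p (\<lambda>j. bhat j \<omega>) (\<lambda>j. \<beta> j \<omega>) - 1\<bar> \<le> \<eta>"
  proof eventually_elim
    case (elim \<omega>)
    show ?case
    proof
      assume "\<omega> \<notin> E"
      hence nE: "\<omega> \<notin> E1" "\<omega> \<notin> E2" "\<omega> \<notin> E3" "\<omega> \<notin> E4" by (auto simp: E_def)
      define Q where "Q = (\<Sum>i<n. (z i \<omega>)\<^sup>2)"
      have y: "y i \<omega> = mat_vec p (\<lambda>i j. X i j \<omega>) (\<lambda>j. \<beta> j \<omega>) i + z i \<omega>" if "i < n" for i
        using lm elim(3) that by (simp add: linear_model_def)
      have \<beta>: "\<beta> j \<omega> \<in> {0, m}" if "j < p" for j using elim(1) that by auto
      note min = l0_minimizer_bounds[OF elim(2) y \<beta> less_imp_le[OF pos(1)], folded S_def T_def Q_def]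
      have Q: "Q \<le> (4 * \<sigma>\<^sup>2 + 1) * n" using nE(2) elim(3) by (simp add: E2_def Q_def)
      have "{j\<in>{..<p}. \<beta> j \<omega> \<noteq> 0} = S \<omega>" by (auto simp: S_def)
      hence "\<bar>card (S \<omega>) - \<epsilon> * p\<bar> < \<tau> * p" using nE(1) elim(3) by (simp add: E1_def not_le)
      hence K: "(\<epsilon> - \<tau>) * p \<le> card (S \<omega>)" "card (S \<omega>) \<le> (\<epsilon> + \<tau>) * p"
        by (auto simp: algebra_simps abs_if split: if_splits)
      have Kp: "real (card (S \<omega>)) \<le> p"
      proof -
        have "card (S \<omega>) \<le> card {..<p}" by (intro card_mono) (auto simp: S_def)
        thus ?thesis by simp
      qed
      \<comment> \<open>Noise energy of at most \<open>m * d\<close> buys at most \<open>d\<close>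
        extra indices at price \<open>m\<close> each.\<close>
      have "m * card (T \<omega>) \<le> m * (card (S \<omega>) + d)"
        using min(1) Q noise(1) by (simp add: algebra_simps)
      hence Tle: "card (T \<omega>) \<le> card (S \<omega>) + d" using pos by simp
      have "card (S \<omega> - T \<omega>) < d"
      proof (rule ccontr)
        assume "\<not> card (S \<omega> - T \<omega>) < d"
        \<comment> \<open>The error \<open>bhat - \<beta>\<close> is the coefficient vector that
          contradicts the small ball bound: its fit term is at most \<open>3 * p\<close> and its
          penalty at most 1.\<close>
        hence "3 * p + 1 < ridge (1 / m) \<kappa> {..<n} (T \<omega>) (\<lambda>i j. X i j \<omega>)
            (\<lambda>i. m * (\<Sum>j\<in>S \<omega> - T \<omega>. X i j \<omega>)) (\<lambda>j. bhat j \<omega> - \<beta> j \<omega>)"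
          using nE(3) elim(3) K Tle t by (intro E3(3)) (auto simp: S_def T_def)
        moreover have "(1 / m) * (\<Sum>i<n. (m * (\<Sum>j\<in>S \<omega> - T \<omega>. X i j \<omega>) -
            (\<Sum>j\<in>T \<omega>. X i j \<omega> * (bhat j \<omega> - \<beta> j \<omega>)))\<^sup>2) \<le> 3 * p"
        proof -
          have "4 * Q + 2 * m * card (S \<omega>) \<le> m * p + 2 * m * p"
          proof (intro add_mono)
            have "4 * Q \<le> 4 * ((4 * \<sigma>\<^sup>2 + 1) * n)" by (intro mult_left_mono Q) auto
            with noise(2) show "4 * Q \<le> m * p" by (simp only: mult.assoc)
          qed (use Kp pos in auto)
          also have "\<dots> = m * (3 * p)" by (simp add: algebra_simps)
          finally show ?thesis using min(2) pos by (simp add: divide_le_eq mult_ac)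
        qed
        moreover have "\<kappa> * (\<Sum>j\<in>T \<omega>. (bhat j \<omega> - \<beta> j \<omega>)\<^sup>2) \<le> 1"
        proof -
          have "\<kappa> * (\<Sum>j\<in>T \<omega>. (bhat j \<omega> - \<beta> j \<omega>)\<^sup>2) \<le> \<kappa> * (\<Sum>j<p. (bhat j \<omega> - \<beta> j \<omega>)\<^sup>2)"
            using pos by (intro mult_left_mono sum_mono2) (auto simp: T_def)
          also have "\<dots> \<le> 1" using nE(4) elim(3) by (simp add: E4_def not_less)
          finally show ?thesis .
        qed
        ultimately show False by (simp add: ridge_def)
      qed
      moreover have "4 * d \<le> \<eta> * card (S \<omega>)"
        using d(1) mult_left_mono[OF K(1) pos(10)] by linarith
      moreover have "2 * d \<le> card (S \<omega>)" using d(2) K(1) by linarith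
      ultimately show "\<bar>FDP p (\<lambda>j. bhat j \<omega>) (\<lambda>j. \<beta> j \<omega>)\<bar> \<le> \<eta> \<and>
          \<bar>TPP p (\<lambda>j. bhat j \<omega>) (\<lambda>j. \<beta> j \<omega>) - 1\<bar> \<le> \<eta>"
        using FDP_TPP_bounds[of p "\<lambda>j. \<beta> j \<omega>" "\<lambda>j. bhat j \<omega>" d \<eta>] Tle pos
        unfolding S_def T_def by auto
    qed
  qed
  with PE Eev show ?thesis unfolding E4_def by blast
qed

text \<open>With \<open>d = h * p\<close> and \<open>t = (\<epsilon> + 2 * \<tau>) * p\<close> every
  exceptional probability tends to zero. The gap \<open>n - t \<ge> 2 * \<tau> * p\<close> turns the
  small ball bound into a multiple of \<open>\<Theta> ^ p\<close>, and the last condition on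
  \<open>m\<close> is exactly \<open>\<Theta> < 1\<close>.\<close>

lemma recovery_tendsto:
  fixes m \<delta> \<epsilon> \<sigma> \<tau> h \<eta> :: real and n p :: "nat \<Rightarrow> nat"
  assumes reg: "proportional_regime \<delta> n p"
    and lm: "\<And>k. linear_model (\<Omega> k) (n k) (p k) \<sigma> (two_point_prior \<epsilon> m) (X k) (\<beta> k) (z k) (y k)"
    and est: "\<And>k. l0_estimator (\<Omega> k) (n k) (p k) (X k) (y k) m (bhat k)"
    and pos: "0 < m" "0 < \<delta>" "0 \<le> \<sigma>" "0 < \<epsilon>" "\<epsilon> < 1" "0 < \<tau>" "0 < h" "0 \<le> \<eta>"
    and \<tau>: "8 * \<tau> \<le> \<delta> - \<epsilon>" "2 * \<tau> \<le> \<epsilon>"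
    and h: "h \<le> \<tau>" "8 * h \<le> \<eta> * \<epsilon>" "4 * h \<le> \<epsilon>"
    and m: "(4 * \<sigma>\<^sup>2 + 1) * (2 * \<delta>) \<le> m * h" "4 * (4 * \<sigma>\<^sup>2 + 1) * (2 * \<delta>) \<le> m" "1 \<le> m * h / \<delta>"
      "4 * exp 3 * (m * h / \<delta>) powr (- \<tau>) < 1"
  shows "(\<lambda>k. measure (\<Omega> k) {\<omega> \<in> space (\<Omega> k).
      \<eta> < \<bar>FDP (p k) (\<lambda>j. bhat k j \<omega>) (\<lambda>j. \<beta> k j \<omega>)\<bar>}) \<longlonglongrightarrow> 0" (is "?F \<longlonglongrightarrow> 0")
    and "(\<lambda>k. measure (\<Omega> k) {\<omega> \<in> space (\<Omega> k).
      \<eta> < \<bar>TPP (p k) (\<lambda>j. bhat k j \<omega>) (\<lambda>j. \<beta> k j \<omega>) - 1\<bar>}) \<longlonglongrightarrow> 0" (is "?G \<longlonglongrightarrow> 0")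
proof -
  have n: "filterlim n at_top sequentially" and p: "filterlim p at_top sequentially"
    and np: "(\<lambda>k. real (n k) / real (p k)) \<longlonglongrightarrow> \<delta>"
    using reg by (auto simp: proportional_regime_def)
  define x \<Theta> where "x = m * h / \<delta>" and "\<Theta> = 4 * exp 3 * x powr (- \<tau>)"
  \<comment> \<open>The four terms bound the probabilities of \<open>E1\<close>, \<open>E2\<close>,
    \<open>E3\<close> and \<open>E4\<close> from \<open>recovery_event\<close>, in this order;
    \<open>exp 1\<close> comes from the extra 1 in the small ball level.\<close>
  define U where "U k = 2 * exp (- 2 * \<tau>\<^sup>2) ^ p k + (sqrt 2 / exp 1) ^ n k + exp 1 * \<Theta> ^ p k + 1 / Suc k" for k
  have lim: "(\<lambda>k. r ^ f k) \<longlonglongrightarrow> 0" if "0 \<le> r" "r < 1" "filterlim f at_top sequentially" for r :: real and f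
    using filterlim_compose[OF LIMSEQ_realpow_zero[OF that(1,2)] that(3)] .
  have "U \<longlonglongrightarrow> 2 * 0 + 0 + exp 1 * 0 + 0"
    unfolding U_def
  proof (intro tendsto_add tendsto_mult tendsto_const lim n p)
    have "sqrt 2 < 2" by (simp add: real_less_lsqrt)
    also have "2 \<le> exp (1 :: real)" using exp_ge_add_one_self[of "1::real"] by simp
    finally show "sqrt 2 / exp 1 < (1 :: real)" by simp
    show "\<Theta> < 1" using m by (simp add: \<Theta>_def x_def)
    show "(\<lambda>k. 1 / real (Suc k)) \<longlonglongrightarrow> 0" using LIMSEQ_Suc[OF lim_1_over_n[where 'a = real]] by simp
  qed (use pos in \<open>auto simp: \<Theta>_def\<close>)
  hence U0: "U \<longlonglongrightarrow> 0" by simp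
  have "eventually (\<lambda>k. \<bar>real (n k) / real (p k) - \<delta>\<bar> < \<tau>) sequentially"
    using tendstoD[OF np pos(6)] by (simp add: dist_real_def)
  moreover have "eventually (\<lambda>k. 1 \<le> n k) sequentially" "eventually (\<lambda>k. 1 \<le> p k) sequentially"
    using n p by (auto simp: filterlim_at_top)
  ultimately have bound: "eventually (\<lambda>k. ?F k \<le> U k \<and> ?G k \<le> U k) sequentially"
  proof eventually_elim
    case (elim k)
    interpret prob_space "\<Omega> k" using lm[of k] by (simp add: linear_model_def)
    have pn: "0 < real (p k)" "0 < real (n k)" using elim by auto
    have nlo: "(\<delta> - \<tau>) * p k \<le> n k" and nhi: "n k \<le> (\<delta> + \<tau>) * p k"
      using elim(1) pn by (auto simp: abs_less_iff field_simps)
    have n2: "n k \<le> 2 * \<delta> * p k"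
    proof -
      have "(\<delta> + \<tau>) * p k \<le> (2 * \<delta>) * p k" using \<tau> pos by (intro mult_right_mono) auto
      with nhi show ?thesis by simp
    qed
    define W where "W \<omega> = (\<Sum>j<p k. (bhat k j \<omega> - \<beta> k j \<omega>)\<^sup>2)" for \<omega>
    have "W \<in> borel_measurable (\<Omega> k)"
    proof -
      have [measurable]: "\<beta> k j \<in> borel_measurable (\<Omega> k)" "bhat k j \<in> borel_measurable (\<Omega> k)" if "j < p k" for j
        using linear_model_indep(2)[OF lm[of k]] est[of k] that by (auto simp: indep_vars_def l0_estimator_def)
      show ?thesis unfolding W_def by measurable
    qed
    \<comment> \<open>the small ball bound does not depend on \<open>\<kappa>\<close>, so \<open>\<kappa>\<close> may depend on \<open>k\<close>: tightness of the
        single random variable \<open>W\<close> suffices, uniformity in \<open>k\<close> is not needed\<close>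
    then obtain \<kappa> where \<kappa>: "\<kappa> > 0" "prob {\<omega> \<in> space (\<Omega> k). 1 < \<kappa> * W \<omega>} < 1 / Suc k"
      using exists_scale_prob_less[of W "1 / Suc k"] by auto
    \<comment> \<open>The two \<open>\<tau>\<close> in \<open>t\<close> absorb the fluctuation of
      the support size and the \<open>d \<le> \<tau> * p\<close> surplus indices. Since
      \<open>n \<ge> (\<delta> - \<tau>) * p\<close>, a linear gap below \<open>n\<close>
      remains.\<close>
    define d t where "d = h * p k" and "t = (\<epsilon> + 2 * \<tau>) * p k"
    have nt: "2 * \<tau> * p k \<le> n k - t"
    proof -
      have "(2 * \<tau> + \<epsilon> + 2 * \<tau>) * p k \<le> (\<delta> - \<tau>) * p k" using \<tau> pos by (intro mult_right_mono) auto
      with nlo show ?thesis by (simp add: t_def algebra_simps)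
    qed
    have "\<exists>E\<in>events. prob E \<le> 2 * exp (- 2 * \<tau>\<^sup>2 * p k) + (sqrt 2 / exp 1) ^ n k +
        4 ^ p k * (exp (3 * p k + 1) * (1 + 2 * (m * d / n k)) powr (- (real (n k) - t) / 2)) +
        prob {\<omega> \<in> space (\<Omega> k). 1 < \<kappa> * (\<Sum>j<p k. (bhat k j \<omega> - \<beta> k j \<omega>)\<^sup>2)} \<and>
      (AE \<omega> in \<Omega> k. \<omega> \<notin> E \<longrightarrow> \<bar>FDP (p k) (\<lambda>j. bhat k j \<omega>) (\<lambda>j. \<beta> k j \<omega>)\<bar> \<le> \<eta> \<and>
        \<bar>TPP (p k) (\<lambda>j. bhat k j \<omega>) (\<lambda>j. \<beta> k j \<omega>) - 1\<bar> \<le> \<eta>)"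
    proof (rule recovery_event[OF lm est])
      have "(4 * \<sigma>\<^sup>2 + 1) * n k \<le> (4 * \<sigma>\<^sup>2 + 1) * (2 * \<delta> * p k)" using n2 by (intro mult_left_mono) auto
      also have "\<dots> \<le> m * h * p k" using mult_right_mono[OF m(1), of "p k"] by (simp add: mult_ac)
      finally show "(4 * \<sigma>\<^sup>2 + 1) * n k \<le> m * d" by (simp add: d_def mult_ac)
      have "4 * (4 * \<sigma>\<^sup>2 + 1) * n k \<le> 4 * (4 * \<sigma>\<^sup>2 + 1) * (2 * \<delta> * p k)" using n2 by (intro mult_left_mono) auto
      also have "\<dots> \<le> m * p k" using mult_right_mono[OF m(2), of "p k"] by (simp add: mult_ac)
      finally show "4 * (4 * \<sigma>\<^sup>2 + 1) * n k \<le> m * p k" .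
      have "h * p k \<le> \<tau> * p k" using h by (intro mult_right_mono) auto
      thus "(\<epsilon> + \<tau>) * p k + d \<le> t" by (simp add: d_def t_def algebra_simps)
      have "0 \<le> 2 * \<tau> * p k" using pos by simp
      with nt show "t \<le> n k" by linarith
      have e: "\<epsilon> / 2 * p k \<le> (\<epsilon> - \<tau>) * p k" using \<tau> by (intro mult_right_mono) auto
      have "4 * h * p k \<le> \<eta> * \<epsilon> / 2 * p k" using h by (intro mult_right_mono) auto
      also have "\<dots> = \<eta> * (\<epsilon> / 2 * p k)" by simp
      also have "\<dots> \<le> \<eta> * ((\<epsilon> - \<tau>) * p k)" using e pos by (intro mult_left_mono) auto
      finally show "4 * d \<le> \<eta> * ((\<epsilon> - \<tau>) * p k)" by (simp add: d_def)
      have "2 * h * p k \<le> \<epsilon> / 2 * p k" using h by (intro mult_right_mono) auto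
      with e show "2 * d \<le> (\<epsilon> - \<tau>) * p k" by (simp add: d_def)
      show "0 < d" using pos pn by (simp add: d_def)
    qed (use pos \<kappa> elim in auto)
    then obtain E where E: "E \<in> events" "prob E \<le> 2 * exp (- 2 * \<tau>\<^sup>2 * p k) + (sqrt 2 / exp 1) ^ n k +
        4 ^ p k * (exp (3 * p k + 1) * (1 + 2 * (m * d / n k)) powr (- (real (n k) - t) / 2)) +
        prob {\<omega> \<in> space (\<Omega> k). 1 < \<kappa> * W \<omega>}"
      and AE: "AE \<omega> in \<Omega> k. \<omega> \<notin> E \<longrightarrow> \<bar>FDP (p k) (\<lambda>j. bhat k j \<omega>) (\<lambda>j. \<beta> k j \<omega>)\<bar> \<le> \<eta> \<and>
        \<bar>TPP (p k) (\<lambda>j. bhat k j \<omega>) (\<lambda>j. \<beta> k j \<omega>) - 1\<bar> \<le> \<eta>"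
      unfolding W_def by blast
    have ex: "exp (real (3 * p k + 1)) = exp 3 ^ p k * exp 1"
      by (simp add: exp_add exp_of_nat2_mult)
    \<comment> \<open>Since \<open>n \<le> 2 * \<delta> * p\<close>, the base is at least
      \<open>x\<close>; the exponent is at most \<open>- \<tau> * p\<close>.\<close>
    have "(1 + 2 * (m * d / n k)) powr (- (real (n k) - t) / 2) \<le> x powr (- (real (n k) - t) / 2)"
    proof (rule powr_mono2')
      have "m * d / n k \<ge> m * d / (2 * \<delta> * p k)"
        using n2 pn pos by (intro divide_left_mono mult_pos_pos) (auto simp: d_def)
      moreover have "m * d / (2 * \<delta> * p k) = x / 2" using pn by (simp add: d_def x_def)
      ultimately show "x \<le> 1 + 2 * (m * d / n k)" by linarith
      have "0 \<le> 2 * \<tau> * p k" using pos by simp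
      with nt have "0 \<le> n k - t" by (rule order_trans[rotated])
      thus "- (real (n k) - t) / 2 \<le> 0" by simp
      show "0 < x" using pos by (simp add: x_def)
    qed
    also have "\<dots> \<le> x powr (- \<tau> * p k)"
      using nt m(3) by (intro powr_mono) (auto simp: x_def)
    also have "\<dots> = (x powr (- \<tau>)) ^ p k"
      using pos by (subst powr_realpow[symmetric]) (auto simp: powr_powr x_def)
    finally have "4 ^ p k * (exp (3 * p k + 1) * (1 + 2 * (m * d / n k)) powr (- (real (n k) - t) / 2)) \<le>
       4 ^ p k * (exp (3 * p k + 1) * (x powr (- \<tau>)) ^ p k)"
      by (intro mult_left_mono) auto
    also note ex
    also have "4 ^ p k * (exp 3 ^ p k * exp 1 * (x powr (- \<tau>)) ^ p k) = exp 1 * \<Theta> ^ p k"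
      by (simp add: \<Theta>_def power_mult_distrib mult_ac)
    finally have "prob E \<le> U k"
      using E(2)[unfolded ex] \<kappa>(2) exp_of_nat2_mult[of "- 2 * \<tau>\<^sup>2" "p k"] unfolding U_def by linarith
    \<comment> \<open>Monotonicity up to null sets matches the almost sure form of the recovery
      statement.\<close>
    moreover have "?F k \<le> prob E" "?G k \<le> prob E"
      using AE by (intro finite_measure_mono_AE E(1); eventually_elim; force)+
    ultimately show ?case by linarith
  qed
  show "?F \<longlonglongrightarrow> 0" "?G \<longlonglongrightarrow> 0"
    using bound by (auto intro!: tendsto_sandwich[OF _ _ tendsto_const U0] elim: eventually_mono)
qed

theorem theorem3p1:
  fixes \<delta> \<epsilon> \<sigma> :: real
  assumes "0 < \<delta>" and "0 < \<epsilon>" and "\<epsilon> < 1" and "\<epsilon> < \<delta>" and "0 \<le> \<sigma>"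
  shows "\<exists>lam :: real \<Rightarrow> real. (\<forall>M>0. lam M > 0) \<and>
    (\<forall>(n :: real \<Rightarrow> nat \<Rightarrow> nat) (p :: real \<Rightarrow> nat \<Rightarrow> nat) (\<Omega> :: real \<Rightarrow> nat \<Rightarrow> 'a measure) X \<beta> z y bhat.
       (\<forall>M>0. proportional_regime \<delta> (n M) (p M)) \<longrightarrow>
       (\<forall>M>0. \<forall>k. linear_model (\<Omega> M k) (n M k) (p M k) \<sigma> (two_point_prior \<epsilon> M)
                    (X M k) (\<beta> M k) (z M k) (y M k)) \<longrightarrow>
       (\<forall>M>0. \<forall>k. l0_estimator (\<Omega> M k) (n M k) (p M k) (X M k) (y M k) (lam M) (bhat M k)) \<longrightarrow>
       iterated_lim_in_prob \<Omega>
         (\<lambda>M k \<omega>. FDP (p M k) (\<lambda>j. bhat M k j \<omega>) (\<lambda>j. \<beta> M k j \<omega>)) 0 \<and>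
       iterated_lim_in_prob \<Omega>
         (\<lambda>M k \<omega>. TPP (p M k) (\<lambda>j. bhat M k j \<omega>) (\<lambda>j. \<beta> M k j \<omega>)) 1)"
proof (intro exI[of _ "\<lambda>M. M"] conjI allI impI)
  fix M :: real assume "M > 0" thus "M > 0" .
next
  fix n p :: "real \<Rightarrow> nat \<Rightarrow> nat" and \<Omega> :: "real \<Rightarrow> nat \<Rightarrow> 'a measure" and X \<beta> z y bhat
  assume reg: "\<forall>M>0. proportional_regime \<delta> (n M) (p M)"
    and lm: "\<forall>M>0. \<forall>k. linear_model (\<Omega> M k) (n M k) (p M k) \<sigma> (two_point_prior \<epsilon> M)
                    (X M k) (\<beta> M k) (z M k) (y M k)"
    and est: "\<forall>M>0. \<forall>k. l0_estimator (\<Omega> M k) (n M k) (p M k) (X M k) (y M k) M (bhat M k)"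
  \<comment> \<open>\<open>\<tau>\<close> is fixed before \<open>\<eta>\<close>: it splits the gap
    between \<open>\<epsilon>\<close> and \<open>\<delta>\<close> among the fluctuations of
    \<open>n / p\<close>, of the support size and of the surplus discoveries, leaving room for the
    small ball exponent.\<close>
  define \<tau> where "\<tau> = min ((\<delta> - \<epsilon>) / 8) (\<epsilon> / 2)"
  have \<tau>: "0 < \<tau>" "8 * \<tau> \<le> \<delta> - \<epsilon>" "2 * \<tau> \<le> \<epsilon>" using assms by (auto simp: \<tau>_def min_def)
  have main: "\<forall>\<^sub>F M in at_top.
      (\<lambda>k. measure (\<Omega> M k) {\<omega> \<in> space (\<Omega> M k).
        \<eta> < \<bar>FDP (p M k) (\<lambda>j. bhat M k j \<omega>) (\<lambda>j. \<beta> M k j \<omega>)\<bar>}) \<longlonglongrightarrow> 0 \<and>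
      (\<lambda>k. measure (\<Omega> M k) {\<omega> \<in> space (\<Omega> M k).
        \<eta> < \<bar>TPP (p M k) (\<lambda>j. bhat M k j \<omega>) (\<lambda>j. \<beta> M k j \<omega>) - 1\<bar>}) \<longlonglongrightarrow> 0"
    if \<eta>: "\<eta> > 0" for \<eta>
  proof -
    \<comment> \<open>\<open>h\<close> is the tolerated number of missed indices as a fraction of
      \<open>p\<close>. It depends on \<open>\<eta>\<close> but not on \<open>M\<close>, so
      \<open>M * h\<close> grows without bound.\<close>
    define h where "h = min \<tau> (min (\<eta> * \<epsilon> / 8) (\<epsilon> / 4))"
    have h: "0 < h" "h \<le> \<tau>" "8 * h \<le> \<eta> * \<epsilon>" "4 * h \<le> \<epsilon>"
      using assms \<tau> \<eta> by (auto simp: h_def)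
    \<comment> \<open>A negative power of \<open>M\<close> beats the constant
      \<open>4 * exp 3\<close> formed by the count of pairs and the small ball level.\<close>
    have "((\<lambda>M. 4 * exp 3 * (M * h / \<delta>) powr (- \<tau>)) \<longlongrightarrow> 0) at_top"
      using h \<tau> assms by real_asymp
    hence "\<forall>\<^sub>F M in at_top. 4 * exp 3 * (M * h / \<delta>) powr (- \<tau>) < 1"
      by (rule order_tendstoD) simp
    \<comment> \<open>The entries of the maximum give, in order, \<open>M > 0\<close>, a base of at
      least one, and the two noise conditions of \<open>recovery_tendsto\<close>.\<close>
    moreover have "\<forall>\<^sub>F M in at_top. max (max 1 (\<delta> / h)) (max ((4 * \<sigma>\<^sup>2 + 1) * (2 * \<delta>) / h)
        (4 * (4 * \<sigma>\<^sup>2 + 1) * (2 * \<delta>))) \<le> M"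
      by (rule eventually_ge_at_top)
    ultimately show ?thesis
    proof eventually_elim
      case (elim M)
      have "0 < M" using elim(2) by simp
      have M: "(4 * \<sigma>\<^sup>2 + 1) * (2 * \<delta>) \<le> M * h" "4 * (4 * \<sigma>\<^sup>2 + 1) * (2 * \<delta>) \<le> M" "1 \<le> M * h / \<delta>"
        using elim(2) h assms by (auto simp: divide_le_eq le_divide_eq)
      show ?case
        using recovery_tendsto[of \<delta> "n M" "p M" "\<Omega> M" \<sigma> \<epsilon> M "X M" "\<beta> M" "z M" "y M" "bhat M" \<tau> h \<eta>]
          reg lm est \<open>0 < M\<close> M h \<tau> \<eta> assms elim(1) by auto
    qed
  qed
  show "iterated_lim_in_prob \<Omega> (\<lambda>M k \<omega>. FDP (p M k) (\<lambda>j. bhat M k j \<omega>) (\<lambda>j. \<beta> M k j \<omega>)) 0"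
    unfolding iterated_lim_in_prob_def by (intro allI impI eventually_mono[OF main]) auto
  show "iterated_lim_in_prob \<Omega> (\<lambda>M k \<omega>. TPP (p M k) (\<lambda>j. bhat M k j \<omega>) (\<lambda>j. \<beta> M k j \<omega>)) 1"
    unfolding iterated_lim_in_prob_def by (intro allI impI eventually_mono[OF main]) auto
qed

end
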